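(* For every integer $n\geq 11$ with $n\equiv 1$ or $5\pmod 6$ and every integer $d$ with $6\le d\le n-3$, there exists a regular SAMS$(n,d)$.
   Context: For positive integers $n,d$ with $d<n$, an $n\times n$ array $A$ with entries in $\{0,1,\dots,nd\}$ is a sparse anti-magic square of order $n$ with density $d$, denoted SAMS$(n,d)$, if each element of $\{1,2,\dots,nd\}$ occurs in exactly one entry of $A$ (all other entries being $0$), and the $n$ row-sums, $n$ column-sums and the two main diagonal sums (left diagonal: entries $(i,i)$; right diagonal: entries $(i,n+1-i)$) together form a set of $2n+2$ consecutive integers. An SAMS$(n,d)$ is regular if each row, each column and each of the two main diagonals contains exactly $d$ positive entries. *)

theory Defs
  imports Main
begin

(* An n x n array is a function on pairs of indices; only its values at indices in
   {1..n} matter. *)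

definition row_sum :: "nat \<Rightarrow> (nat \<Rightarrow> nat \<Rightarrow> nat) \<Rightarrow> nat \<Rightarrow> nat" where
  "row_sum n A i = (\<Sum>j = 1..n. A i j)"

definition col_sum :: "nat \<Rightarrow> (nat \<Rightarrow> nat \<Rightarrow> nat) \<Rightarrow> nat \<Rightarrow> nat" where
  "col_sum n A j = (\<Sum>i = 1..n. A i j)"

definition left_diag_sum :: "nat \<Rightarrow> (nat \<Rightarrow> nat \<Rightarrow> nat) \<Rightarrow> nat" where
  "left_diag_sum n A = (\<Sum>i = 1..n. A i i)"

definition right_diag_sum :: "nat \<Rightarrow> (nat \<Rightarrow> nat \<Rightarrow> nat) \<Rightarrow> nat" where
  "right_diag_sum n A = (\<Sum>i = 1..n. A i (n + 1 - i))"

definition line_sums :: "nat \<Rightarrow> (nat \<Rightarrow> nat \<Rightarrow> nat) \<Rightarrow> nat set" where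
  "line_sums n A =
     row_sum n A ` {1..n} \<union> col_sum n A ` {1..n} \<union> {left_diag_sum n A, right_diag_sum n A}"

(* In the last conjunct the interval has exactly 2 * n + 2 elements, so the equation
   also forces the 2 * n + 2 sums to be pairwise distinct. *)
definition sams :: "nat \<Rightarrow> nat \<Rightarrow> (nat \<Rightarrow> nat \<Rightarrow> nat) \<Rightarrow> bool" where
  "sams n d A \<longleftrightarrow>
     0 < d \<and> d < n \<and>
     (\<forall>i\<in>{1..n}. \<forall>j\<in>{1..n}. A i j \<in> {0..n * d}) \<and>
     (\<forall>k\<in>{1..n * d}. \<exists>!p. p \<in> {1..n} \<times> {1..n} \<and> A (fst p) (snd p) = k) \<and>
     (\<exists>a. line_sums n A = {a..<a + (2 * n + 2)})"

definition regular_sams :: "nat \<Rightarrow> nat \<Rightarrow> (nat \<Rightarrow> nat \<Rightarrow> nat) \<Rightarrow> bool" where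
  "regular_sams n d A \<longleftrightarrow>
     sams n d A \<and>
     (\<forall>i\<in>{1..n}. card {j \<in> {1..n}. 0 < A i j} = d) \<and>
     (\<forall>j\<in>{1..n}. card {i \<in> {1..n}. 0 < A i j} = d) \<and>
     card {i \<in> {1..n}. 0 < A i i} = d \<and>
     card {i \<in> {1..n}. 0 < A i (n + 1 - i)} = d"

end

theory Submission
  imports Defs "HOL-Number_Theory.Cong"
begin

text \<open>
  Since \<open>n\<close> is coprime to 6, for every \<open>a\<close> the cells \<open>(i, j)\<close> with \<open>j = 2 (i + a)\<close> modulo \<open>n\<close> form a class that
  meets each row, each column and each main diagonal exactly once (a Knut Vik design). Choose \<open>d\<close>
  classes and fill the \<open>k\<close>-th one with a permutation of the \<open>k\<close>-th block of \<open>n\<close> consecutive integers.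
  After centring the blocks at 0, the line sums have to be the numbers from \<open>-n\<close> to \<open>n + 1\<close>.

  A skeleton of two or three classes filled by linear functions gives row and column sums that are
  almost right: only one column sum 1 has to become \<open>n + 1\<close> and one column sum 0 has to become
  \<open>-n\<close>, leaving 1 and \<open>n\<close> for the diagonals. Four or six twisting classes of the form \<open>f, -f, -f', f'\<close>,
  where \<open>f - f'\<close> takes just two values, cancel in every row and make exactly this correction in the
  columns. There is enough freedom in \<open>f'\<close> to prescribe both diagonal sums. This settles
  \<open>d = 6, 7, 8, 9\<close>, and four consecutive classes can be filled so that they contribute 0 to every
  line, which allows adding 4 to \<open>d\<close> repeatedly.
\<close>

section \<open>Sums and counts along a line, completion of injections, residue
  representatives\<close>

text \<open>A line \<open>S\<close> meets each class in exactly one cell, so after exchanging the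
  two sums the inner one collapses to the single value \<open>w t\<close>.\<close>

lemma sum_over_hits:
  fixes val :: "nat \<Rightarrow> 's \<Rightarrow> nat"
  assumes fin: "finite S"
    and ex: "\<And>t. t < d \<Longrightarrow> \<exists>!s. s \<in> S \<and> hit t s"
    and val: "\<And>t s. t < d \<Longrightarrow> s \<in> S \<Longrightarrow> hit t s \<Longrightarrow> val t s = w t"
  shows "(\<Sum>s\<in>S. \<Sum>t<d. if hit t s then val t s else 0) = (\<Sum>t<d. w t)"
proof -
  have "(\<Sum>s\<in>S. if hit t s then val t s else 0) = w t" if td: "t < d" for t
  proof -
    have "\<exists>s0. (s0 \<in> S \<and> hit t s0) \<and> (\<forall>s. s \<in> S \<and> hit t s \<longrightarrow> s = s0)"
      using ex[OF td] unfolding Ex1_def by simp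
    then obtain s0 where s0: "(s0 \<in> S \<and> hit t s0) \<and> (\<forall>s. s \<in> S \<and> hit t s \<longrightarrow> s = s0)"
      by (rule exE)
    have "(\<Sum>s\<in>S. if hit t s then val t s else 0) = (\<Sum>s\<in>S. if s = s0 then w t else 0)"
      using s0 val[OF td] by (intro sum.cong) auto
    then show ?thesis
      using s0 fin by simp
  qed
  then show ?thesis
    by (subst sum.swap) simp
qed

text \<open>Sending a class to its cell on the line is injective because the classes are disjoint
  there; since entries are positive, the image is exactly the set of positive cells.\<close>

lemma card_hits:
  fixes val :: "nat \<Rightarrow> 's \<Rightarrow> nat"
  assumes fin: "finite S"
    and ex: "\<And>t. t < d \<Longrightarrow> \<exists>!s. s \<in> S \<and> hit t s"
    and disj: "\<And>t t' s. t < d \<Longrightarrow> t' < d \<Longrightarrow> s \<in> S \<Longrightarrow> hit t s \<Longrightarrow> hit t' s \<Longrightarrow> t = t'"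
    and pos: "\<And>t s. t < d \<Longrightarrow> s \<in> S \<Longrightarrow> hit t s \<Longrightarrow> 0 < val t s"
  shows "card {s \<in> S. 0 < (\<Sum>t<d. if hit t s then val t s else 0)} = d"
proof -
  have "\<exists>\<sigma>. \<forall>t<d. \<sigma> t \<in> S \<and> hit t (\<sigma> t)"
    using ex by metis
  then obtain \<sigma> where \<sigma>: "\<And>t. t < d \<Longrightarrow> \<sigma> t \<in> S \<and> hit t (\<sigma> t)"
    by blast
  have "{s \<in> S. 0 < (\<Sum>t<d. if hit t s then val t s else 0)} = {s \<in> S. \<exists>t<d. hit t s}"
  proof -
    have "0 < (\<Sum>t<d. if hit t s then val t s else 0) \<longleftrightarrow> (\<exists>t<d. hit t s)" if "s \<in> S" for s
    proof -
      have "(\<Sum>t<d. if hit t s then val t s else 0) = 0 \<longleftrightarrow> (\<forall>t<d. \<not> hit t s)"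
        using pos[OF _ that] by (auto simp: sum_eq_0_iff)
      then show ?thesis by (simp only: neq0_conv[symmetric] not_all not_imp not_not)
    qed
    then show ?thesis by blast
  qed
  also have "\<dots> = \<sigma> ` {..<d}"
  proof (intro equalityI subsetI)
    fix s assume "s \<in> {s \<in> S. \<exists>t<d. hit t s}"
    then obtain t where t: "s \<in> S" "t < d" "hit t s" by blast
    then have "s = \<sigma> t" using \<sigma>[OF t(2)] ex[OF t(2)] by metis
    then show "s \<in> \<sigma> ` {..<d}" using t by blast
  next
    fix s assume "s \<in> \<sigma> ` {..<d}"
    then show "s \<in> {s \<in> S. \<exists>t<d. hit t s}" using \<sigma> by blast
  qed
  finally have eq: "{s \<in> S. 0 < (\<Sum>t<d. if hit t s then val t s else 0)} = \<sigma> ` {..<d}" .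
  have "inj_on \<sigma> {..<d}"
  proof (rule inj_onI)
    fix t t' assume "t \<in> {..<d}" "t' \<in> {..<d}" "\<sigma> t = \<sigma> t'"
    then show "t = t'" using \<sigma>[of t] \<sigma>[of t'] disj[of t t' "\<sigma> t"] by simp
  qed
  then show ?thesis
    unfolding eq by (simp add: card_image)
qed

text \<open>\<open>S\<close> and its image have equally many elements, hence so do their complements
  in \<open>A\<close>; glue \<open>f\<close> with any bijection between the complements.\<close>

lemma extend_injection:
  assumes "finite A" "S \<subseteq> A" "inj_on f S" "f ` S \<subseteq> A"
  shows "\<exists>g. bij_betw g A A \<and> (\<forall>x\<in>S. g x = f x)"
proof -
  have fS: "finite S" using assms finite_subset by blast
  have "card (A - S) = card (A - f ` S)"
    using assms fS by (simp add: card_Diff_subset card_image)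
  then obtain g where g: "bij_betw g (A - S) (A - f ` S)"
    using assms(1) finite_same_card_bij by blast
  let ?k = "\<lambda>x. if x \<in> S then f x else g x"
  have "bij_betw ?k S (f ` S)"
    using assms(3) by (subst bij_betw_cong[where g = f]) (auto simp: bij_betw_def)
  moreover have "bij_betw ?k (A - S) (A - f ` S)"
    using g by (subst bij_betw_cong[where g = g]) auto
  ultimately have "bij_betw ?k (S \<union> (A - S)) (f ` S \<union> (A - f ` S))"
    by (rule bij_betw_combine) blast
  then have "bij_betw ?k A A"
    using assms by (simp add: Un_absorb1)
  then show ?thesis by (intro exI[of _ ?k]) simp
qed

lemma ex1_residue:
  fixes x :: int
  assumes "N > 0"
  shows "\<exists>!i. i \<in> {1..N} \<and> [int i = x] (mod int N)"
proof (rule ex1I)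
  \<comment> \<open>Reducing \<open>x - 1\<close> and adding 1 gives the representative in
    \<open>{1..N}\<close> instead of \<open>{0..<N}\<close>.\<close>
  let ?i = "nat ((x - 1) mod int N) + 1"
  have r: "0 \<le> (x - 1) mod int N" "(x - 1) mod int N < int N"
    using assms by simp_all
  have "[(x - 1) mod int N + 1 = (x - 1) + 1] (mod int N)"
    by (intro cong_add) simp_all
  then show "?i \<in> {1..N} \<and> [int ?i = x] (mod int N)"
    using r by (auto simp: add.commute)
next
  fix i assume i: "i \<in> {1..N} \<and> [int i = x] (mod int N)"
  then have "[int i - 1 = x - 1] (mod int N)"
    by (intro cong_diff) simp_all
  then have "int i - 1 = (x - 1) mod int N"
    using i by (simp add: cong_def)
  then show "i = nat ((x - 1) mod int N) + 1"
    using i by auto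
qed

text \<open>
  A list of pairs \<open>(a, p)\<close> stands for classes \<open>a\<close> with (centred) entries \<open>p v\<close> in row \<open>v\<close>; the cell
  lies in the column \<open>y = v + a\<close>. On a diagonal \<open>v\<close> is an affine function of \<open>a\<close>, with slope \<open>-2\<close> or \<open>-2/3\<close>.
\<close>

definition line_total :: "(int \<times> (int \<Rightarrow> int)) list \<Rightarrow> (int \<Rightarrow> int) \<Rightarrow> int" where
  "line_total cs w = (\<Sum>(a, p)\<leftarrow>cs. p (w a))"

lemma line_total_simps [simp]:
  "line_total [] w = 0"
  "line_total ((a, p) # cs) w = p (w a) + line_total cs w"
  "line_total (cs @ ds) w = line_total cs w + line_total ds w"
  by (simp_all add: line_total_def)

subsection \<open>Arrays from Knut Vik classes\<close>

text \<open>An odd \<open>n\<close> together with an inverse \<open>t\<close> of 3 encodes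
  coprimality to 6, and \<open>t\<close> solves the equation of the right diagonal. The bound on
  \<open>m\<close> means order at least 11.\<close>

locale knut_vik =
  fixes n m t :: int
  assumes n_eq: "n = 2 * m + 1" and m_ge: "m \<ge> 5" and third: "[3 * t = 1] (mod n)"
begin

definition cen :: "int \<Rightarrow> int" where
  "cen v = (v + m) mod n - m"

text \<open>A permutation of the centred block \<open>{-m..m}\<close> indexed by residues: the
  equivalence gives periodicity modulo \<open>n\<close> and injectivity at once, and surjectivity
  follows by counting.\<close>

definition bperm :: "(int \<Rightarrow> int) \<Rightarrow> bool" where
  "bperm p \<longleftrightarrow> (\<forall>u v. p u = p v \<longleftrightarrow> [u = v] (mod n)) \<and> (\<forall>v. \<bar>p v\<bar> \<le> m)"

lemma n_pos: "n > 0"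
  using n_eq m_ge by simp

lemma cen_cong: "[cen v = v] (mod n)"
  unfolding cen_def cong_def by (metis add_diff_cancel_right' mod_diff_left_eq)

lemma cen_abs_le: "\<bar>cen v\<bar> \<le> m"
proof -
  have "0 \<le> (v + m) mod n" "(v + m) mod n < n" using n_pos by simp_all
  then show ?thesis using n_eq unfolding cen_def by linarith
qed

lemma cen_eqI:
  assumes "[v = w] (mod n)" "\<bar>w\<bar> \<le> m"
  shows "cen v = w"
proof -
  have "(v + m) mod n = (w + m) mod n"
    using assms(1) unfolding cong_def by (metis mod_add_left_eq)
  also have "\<dots> = w + m"
    using assms(2) n_eq by (intro mod_pos_pos_trivial) linarith+
  finally show ?thesis by (simp add: cen_def)
qed

lemma cen_eq_iff: "cen u = cen v \<longleftrightarrow> [u = v] (mod n)"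
  using cen_cong[of u] cen_cong[of v] cen_eqI[of u "cen v"] cen_abs_le[of v]
  by (metis cong_sym cong_trans)

lemma cen_small [simp]: "\<bar>w\<bar> \<le> m \<Longrightarrow> cen w = w"
  by (rule cen_eqI) simp_all

lemma bpermD: "bperm p \<Longrightarrow> [u = v] (mod n) \<Longrightarrow> p u = p v"
  by (simp add: bperm_def)

lemma bperm_uminus: "bperm p \<Longrightarrow> bperm (\<lambda>v. - p v)"
  by (simp add: bperm_def)

lemma bperm_affine:
  assumes "bperm p" "coprime g n"
  shows "bperm (\<lambda>v. p (g * v + b))"
proof -
  have "[g * u + b = g * v + b] (mod n) \<longleftrightarrow> [u = v] (mod n)" for u v
    using assms(2) by (simp add: cong_add_rcancel cong_mult_lcancel)
  then show ?thesis using assms(1) by (simp add: bperm_def)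
qed

lemma bperm_shift: "bperm p \<Longrightarrow> bperm (\<lambda>v. p (v + b))"
  using bperm_affine[of p 1 b] by simp

lemma bperm_of_cen: "bperm cen"
  using cen_eq_iff cen_abs_le by (simp add: bperm_def)

lemma bperm_surj:
  assumes "bperm p" "\<bar>x\<bar> \<le> m"
  shows "\<exists>v. p v = x"
proof -
  have "inj_on p {-m..m}"
  proof (rule inj_onI)
    fix u v assume "u \<in> {-m..m}" "v \<in> {-m..m}" "p u = p v"
    then have "cen u = cen v" using assms(1) cen_eq_iff by (simp add: bperm_def)
    with \<open>u \<in> _\<close> \<open>v \<in> _\<close> show "u = v" using cen_small[of u] cen_small[of v] by (simp add: abs_le_iff)
  qed
  moreover have "p ` {-m..m} \<subseteq> {-m..m}"
  proof
    fix y assume "y \<in> p ` {-m..m}"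
    then obtain v where "y = p v" by blast
    moreover have "\<bar>p v\<bar> \<le> m" using assms(1) by (simp add: bperm_def)
    ultimately show "y \<in> {-m..m}" by (auto simp: abs_le_iff)
  qed
  ultimately have "p ` {-m..m} = {-m..m}"
    by (simp add: endo_inj_surj)
  moreover have "x \<in> {-m..m}" using assms(2) by (auto simp: abs_le_iff)
  ultimately show ?thesis by (metis imageE)
qed

lemma coprime_2: "coprime 2 n"
  using n_eq by simp

lemma coprime_3: "coprime 3 n"
  using third coprime_iff_invertible_int by blast

text \<open>\<open>m + 1\<close> is the inverse of 2, because
  \<open>2 * (m + 1) = n + 1\<close>.\<close>

lemma half: "[2 * ((m + 1) * x) = x] (mod n)"
proof -
  have "2 * ((m + 1) * x) - x = n * x"
    unfolding n_eq by (simp add: algebra_simps)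
  then show ?thesis by (simp add: cong_iff_dvd_diff)
qed

lemma line_total_nth: "line_total cs w = (\<Sum>k<length cs. snd (cs ! k) (w (fst (cs ! k))))"
  unfolding line_total_def
  by (simp add: sum_list_sum_nth atLeast0LessThan case_prod_beta)

lemma line_total_cong:
  assumes "\<forall>(a, p)\<in>set cs. bperm p" "\<And>a. [w a = w' a] (mod n)"
  shows "line_total cs w = line_total cs w'"
  unfolding line_total_def using assms bpermD by (intro arg_cong[where f = sum_list] map_cong) auto

text \<open>
  The rows are shifted by \<open>\<alpha>\<close> and the columns by \<open>\<beta>\<close>, so that the cell of class \<open>a\<close> in row \<open>v\<close> is on the
  left diagonal iff \<open>v = \<beta> - \<alpha> - 2 a\<close>, and on the right one iff \<open>3 v = \<alpha> + \<beta> - 2 a\<close>.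
\<close>

lemma regular_sams_of_classes:
  fixes N :: nat and \<alpha> \<beta> :: int
  assumes N: "n = int N" and d0: "0 < length cs" and dN: "length cs < N"
    and dist: "distinct (map (\<lambda>(a, p). a mod n) cs)"
    and perm: "\<forall>(a, p)\<in>set cs. bperm p"
    and totals: "range (\<lambda>v. line_total cs (\<lambda>_. v)) \<union> range (\<lambda>y. line_total cs (\<lambda>a. y - a)) \<union>
      {line_total cs (\<lambda>a. \<beta> - \<alpha> - 2 * a), line_total cs (\<lambda>a. t * (\<alpha> + \<beta> - 2 * a))} = {-n..n + 1}"
  shows "\<exists>A. regular_sams N (length cs) A"
proof -
  define d where "d = length cs"
  define a where "a k = fst (cs ! k)" for k
  define p where "p k = snd (cs ! k)" for k
  \<comment> \<open>\<open>v\<close> and \<open>c\<close> are centred and shifted indices. The class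
    coordinate of a column is half of \<open>c\<close> modulo \<open>n\<close>, so
    \<open>c = 2 * (v + a)\<close> expresses \<open>y = v + a\<close>.\<close>
  define v where "v i = int i - m - 1 + \<alpha>" for i :: nat
  define c where "c j = int j - m - 1 + \<beta>" for j :: nat
  define hit where "hit k i j \<longleftrightarrow> [2 * (v i + a k) = c j] (mod n)" for k i j
  \<comment> \<open>Class \<open>k\<close> receives the block from \<open>k * n + 1\<close> to
    \<open>(k + 1) * n\<close>, whose centre is \<open>k * n + m + 1\<close>.\<close>
  define val where "val k i = nat (int k * n + m + 1 + p k (v i))" for k i
  define A where "A i j = (\<Sum>k<d. if hit k i j then val k i else 0)" for i j
  have N0: "N > 0" using dN by simp
  have permk: "bperm (p k)" if "k < d" for k
    using perm nth_mem[of k cs] that unfolding p_def d_def by (auto simp: case_prod_beta)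
  have pb: "\<bar>p k x\<bar> \<le> m" if "k < d" for k x
    using permk[OF that] by (simp add: bperm_def)
  have disj: "k = k'" if "k < d" "k' < d" "hit k i j" "hit k' i j" for k k' i j
  proof -
    have "[2 * (v i + a k) = 2 * (v i + a k')] (mod n)"
      using that(3,4) unfolding hit_def by (metis cong_sym cong_trans)
    then have "[v i + a k = v i + a k'] (mod n)"
      using coprime_2 by (simp only: cong_mult_lcancel)
    then have "[a k = a k'] (mod n)"
      by (simp only: cong_add_lcancel)
    then have "a k mod n = a k' mod n"
      by (simp only: cong_def)
    then show ?thesis
      using dist that(1,2) nth_eq_iff_index_eq[OF dist, of k k'] unfolding d_def a_def
      by (simp add: case_prod_beta)
  qed
  \<comment> \<open>Columns and diagonals are summed over row indices, so their cell in a class is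
    found by solving one congruence for \<open>v i\<close>.\<close>
  have ex_of: "\<exists>!i. i \<in> {1..N} \<and> Q i"
    if "\<And>i. Q i \<longleftrightarrow> [v i = x] (mod n)" for Q x
  proof -
    have "Q i \<longleftrightarrow> [int i = x + (m + 1 - \<alpha>)] (mod int N)" for i
    proof -
      have "[v i = x] (mod n) \<longleftrightarrow> [v i + (m + 1 - \<alpha>) = x + (m + 1 - \<alpha>)] (mod n)"
        by (simp only: cong_add_rcancel)
      then show ?thesis using that N by (simp add: v_def)
    qed
    then show ?thesis using ex1_residue[OF N0, of "x + (m + 1 - \<alpha>)"] by simp
  qed
  have row_ex: "\<exists>!j. j \<in> {1..N} \<and> hit k i j" for k i
  proof -
    have "hit k i j \<longleftrightarrow> [int j = 2 * (v i + a k) + (m + 1 - \<beta>)] (mod int N)" for j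
    proof -
      have "hit k i j \<longleftrightarrow> [c j = 2 * (v i + a k)] (mod n)"
        unfolding hit_def by (rule cong_sym_eq)
      also have "\<dots> \<longleftrightarrow> [c j + (m + 1 - \<beta>) = 2 * (v i + a k) + (m + 1 - \<beta>)] (mod n)"
        by (simp only: cong_add_rcancel)
      finally show ?thesis using N by (simp add: c_def)
    qed
    then show ?thesis using ex1_residue[OF N0, of "2 * (v i + a k) + (m + 1 - \<beta>)"] by simp
  qed
  have col_hit: "hit k i j \<longleftrightarrow> [v i = (m + 1) * c j - a k] (mod n)" for k i j
  proof -
    have "hit k i j \<longleftrightarrow> [2 * (v i + a k) = 2 * ((m + 1) * c j)] (mod n)"
      unfolding hit_def using half[of "c j"] by (meson cong_sym cong_trans)
    also have "\<dots> \<longleftrightarrow> [v i + a k = (m + 1) * c j] (mod n)"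
      using coprime_2 by (simp only: cong_mult_lcancel)
    also have "\<dots> \<longleftrightarrow> [v i + a k = ((m + 1) * c j - a k) + a k] (mod n)"
      by simp
    also have "\<dots> \<longleftrightarrow> [v i = (m + 1) * c j - a k] (mod n)"
      by (simp only: cong_add_rcancel)
    finally show ?thesis .
  qed
  have left_hit: "hit k i i \<longleftrightarrow> [v i = \<beta> - \<alpha> - 2 * a k] (mod n)" for k i
    unfolding hit_def cong_iff_dvd_diff c_def v_def by (simp add: algebra_simps)
  have right_hit: "hit k i (N + 1 - i) \<longleftrightarrow> [v i = t * (\<alpha> + \<beta> - 2 * a k)] (mod n)"
    if "i \<in> {1..N}" for k i
  proof -
    have j: "int (N + 1 - i) = 2 * m + 2 - int i"
      using that N n_eq by auto
    have "hit k i (N + 1 - i) \<longleftrightarrow> [3 * v i = \<alpha> + \<beta> - 2 * a k] (mod n)"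
      unfolding hit_def cong_iff_dvd_diff c_def v_def j by (simp add: algebra_simps)
    moreover have "[3 * (t * (\<alpha> + \<beta> - 2 * a k)) = \<alpha> + \<beta> - 2 * a k] (mod n)"
      using cong_mult[OF third cong_refl[of "\<alpha> + \<beta> - 2 * a k"]] by (simp add: mult.assoc)
    ultimately have "hit k i (N + 1 - i) \<longleftrightarrow> [3 * v i = 3 * (t * (\<alpha> + \<beta> - 2 * a k))] (mod n)"
      by (meson cong_sym cong_trans)
    then show ?thesis
      using coprime_3 by (simp only: cong_mult_lcancel)
  qed
  have val_pos: "0 < val k i" if "k < d" for k i
    using pb[OF that, of "v i"] n_pos unfolding val_def by (simp add: abs_le_iff add.assoc add_nonneg_pos)
  have val_cong: "val k i = nat (int k * n + m + 1 + p k x)" if "k < d" "[v i = x] (mod n)" for k i x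
    unfolding val_def using bpermD[OF permk[OF that(1)] that(2)] by simp
  \<comment> \<open>The block centres contribute the same amount \<open>K\<close> to every
    line.\<close>
  define K where "K = (\<Sum>k<d. int k * n + m + 1)"
  have int_total: "int (\<Sum>k<d. nat (int k * n + m + 1 + p k (w (a k)))) = K + line_total cs w" for w
  proof -
    have "int (\<Sum>k<d. nat (int k * n + m + 1 + p k (w (a k)))) =
        (\<Sum>k<d. (int k * n + m + 1) + p k (w (a k)))"
      unfolding of_nat_sum
    proof (rule sum.cong)
      fix k assume "k \<in> {..<d}"
      then have "\<bar>p k (w (a k))\<bar> \<le> m" using pb by simp
      moreover have "0 \<le> int k * n" using n_pos by simp
      ultimately show "int (nat (int k * n + m + 1 + p k (w (a k)))) = (int k * n + m + 1) + p k (w (a k))"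
        by linarith
    qed simp
    then show ?thesis
      unfolding sum.distrib K_def line_total_nth d_def a_def p_def by simp
  qed
  have row: "int (row_sum N A i) = K + line_total cs (\<lambda>_. v i)"
    and row_card: "card {j \<in> {1..N}. 0 < A i j} = d" for i
  proof -
    have "row_sum N A i = (\<Sum>k<d. nat (int k * n + m + 1 + p k (v i)))"
      unfolding row_sum_def A_def using row_ex by (intro sum_over_hits) (auto simp: val_def)
    then show "int (row_sum N A i) = K + line_total cs (\<lambda>_. v i)"
      using int_total[of "\<lambda>_. v i"] by simp
    show "card {j \<in> {1..N}. 0 < A i j} = d"
      unfolding A_def by (rule card_hits) (use row_ex disj val_pos in blast)+
  qed
  have col: "int (col_sum N A j) = K + line_total cs (\<lambda>a. (m + 1) * c j - a)"
    and col_card: "card {i \<in> {1..N}. 0 < A i j} = d" for j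
  proof -
    note ex = ex_of[OF col_hit]
    have "col_sum N A j = (\<Sum>k<d. nat (int k * n + m + 1 + p k ((m + 1) * c j - a k)))"
      unfolding col_sum_def A_def
      by (rule sum_over_hits) (use ex val_cong col_hit in auto)
    then show "int (col_sum N A j) = K + line_total cs (\<lambda>a. (m + 1) * c j - a)"
      using int_total[of "\<lambda>a. (m + 1) * c j - a"] by simp
    show "card {i \<in> {1..N}. 0 < A i j} = d"
      unfolding A_def by (rule card_hits) (use ex disj val_pos in blast)+
  qed
  have left: "int (left_diag_sum N A) = K + line_total cs (\<lambda>a. \<beta> - \<alpha> - 2 * a)"
    and left_card: "card {i \<in> {1..N}. 0 < A i i} = d"
  proof -
    note ex = ex_of[OF left_hit]
    have "left_diag_sum N A = (\<Sum>k<d. nat (int k * n + m + 1 + p k (\<beta> - \<alpha> - 2 * a k)))"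
      unfolding left_diag_sum_def A_def
      by (rule sum_over_hits) (use ex val_cong left_hit in auto)
    then show "int (left_diag_sum N A) = K + line_total cs (\<lambda>a. \<beta> - \<alpha> - 2 * a)"
      using int_total[of "\<lambda>a. \<beta> - \<alpha> - 2 * a"] by simp
    show "card {i \<in> {1..N}. 0 < A i i} = d"
      unfolding A_def by (rule card_hits) (use ex disj val_pos in blast)+
  qed
  have right: "int (right_diag_sum N A) = K + line_total cs (\<lambda>a. t * (\<alpha> + \<beta> - 2 * a))"
    and right_card: "card {i \<in> {1..N}. 0 < A i (N + 1 - i)} = d"
  proof -
    have ex: "\<exists>!i. i \<in> {1..N} \<and> hit k i (N + 1 - i)" for k
    proof -
      have "i \<in> {1..N} \<and> hit k i (N + 1 - i) \<longleftrightarrow>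
          i \<in> {1..N} \<and> [v i = t * (\<alpha> + \<beta> - 2 * a k)] (mod n)" for i
        using right_hit by blast
      then show ?thesis using ex_of[of _ "t * (\<alpha> + \<beta> - 2 * a k)", OF refl] by simp
    qed
    have "right_diag_sum N A = (\<Sum>k<d. nat (int k * n + m + 1 + p k (t * (\<alpha> + \<beta> - 2 * a k))))"
      unfolding right_diag_sum_def A_def
      by (rule sum_over_hits) (use ex val_cong right_hit in auto)
    then show "int (right_diag_sum N A) = K + line_total cs (\<lambda>a. t * (\<alpha> + \<beta> - 2 * a))"
      using int_total[of "\<lambda>a. t * (\<alpha> + \<beta> - 2 * a)"] by simp
    show "card {i \<in> {1..N}. 0 < A i (N + 1 - i)} = d"
      unfolding A_def by (rule card_hits) (use ex disj val_pos in blast)+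
  qed
  have A_hit: "A i j = val k i" if "k < d" "hit k i j" for k i j
  proof -
    have "A i j = (\<Sum>k'<d. if k' = k then val k i else 0)"
      unfolding A_def using disj that by (intro sum.cong) auto
    then show ?thesis using that(1) by simp
  qed
  have val_int: "int (val k i) = int k * n + m + 1 + p k (v i)" if "k < d" for k i
  proof -
    have "0 \<le> int k * n" using n_pos by simp
    then show ?thesis using pb[OF that, of "v i"] unfolding val_def by linarith
  qed
  have A_pos_hit: "\<exists>k<d. hit k i j" if "0 < A i j" for i j
  proof (rule ccontr)
    assume "\<not> (\<exists>k<d. hit k i j)"
    then have "A i j = 0" unfolding A_def by (intro sum.neutral) auto
    then show False using that by simp
  qed
  have A_le: "A i j \<le> N * d" for i j
  proof (cases "0 < A i j")
    case True
    then obtain k where k: "k < d" "hit k i j" using A_pos_hit by blast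
    have "int (A i j) \<le> (int k + 1) * n"
      using A_hit[OF k] val_int[OF k(1), of i] pb[OF k(1), of "v i"] n_eq by (simp add: algebra_simps)
    also have "\<dots> \<le> int d * n"
      using k(1) n_pos by (intro mult_right_mono) auto
    finally show ?thesis using N by (simp add: mult.commute flip: of_nat_mult)
  qed simp
  \<comment> \<open>Division of \<open>x - 1\<close> by \<open>N\<close> recovers the block
    \<open>k\<close> and the offset \<open>r\<close>. The permutation \<open>p k\<close> takes the
    value \<open>r - m\<close> in exactly one row, and the class then determines the column.\<close>
  have once: "\<exists>!q. q \<in> {1..N} \<times> {1..N} \<and> A (fst q) (snd q) = x" if x: "x \<in> {1..N * d}" for x
  proof -
    define k where "k = (x - 1) div N"
    define r where "r = (x - 1) mod N"
    have kd: "k < d" unfolding k_def using x N0 by (auto simp: less_mult_imp_div_less mult.commute)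
    have rN: "r < N" unfolding r_def using N0 by simp
    have xkr: "int x = int k * n + 1 + int r"
    proof -
      have "x - 1 = k * N + r" unfolding k_def r_def by simp
      then have "x = k * N + r + 1" using x by auto
      then show ?thesis using N by simp
    qed
    have "\<bar>int r - m\<bar> \<le> m" using rN N n_eq by linarith
    then obtain u where u: "p k u = int r - m"
      using bperm_surj[OF permk[OF kd]] by blast
    obtain i where i: "i \<in> {1..N}" "[v i = u] (mod n)"
      using ex_of[of "\<lambda>i. [v i = u] (mod n)" u] by blast
    obtain j where j: "j \<in> {1..N}" "hit k i j"
      using row_ex[of k i] by blast
    have pvi: "p k (v i) = int r - m"
      using bpermD[OF permk[OF kd] i(2)] u by simp
    have Aij: "A i j = x"
    proof -
      have "int (A i j) = int x"
        using A_hit[OF kd j(2)] val_int[OF kd, of i] xkr pvi by simp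
      then show ?thesis by simp
    qed
    show ?thesis
    proof (rule ex1I[of _ "(i, j)"])
      show "(i, j) \<in> {1..N} \<times> {1..N} \<and> A (fst (i, j)) (snd (i, j)) = x"
        using i j Aij by simp
    next
      fix q assume q: "q \<in> {1..N} \<times> {1..N} \<and> A (fst q) (snd q) = x"
      obtain i' j' where ij: "q = (i', j')" by (cases q)
      have in': "i' \<in> {1..N}" "j' \<in> {1..N}" "A i' j' = x" using q ij by auto
      then obtain k' where k': "k' < d" "hit k' i' j'" using A_pos_hit[of i' j'] x by auto
      define r' where "r' = nat (m + p k' (v i'))"
      have r': "int r' = m + p k' (v i')" "r' < N"
        using pb[OF k'(1), of "v i'"] n_eq N unfolding r'_def by linarith+
      have "int x = int k' * n + 1 + int r'"
        using A_hit[OF k'] val_int[OF k'(1), of i'] in'(3) r'(1) by simp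
      then have "int (x - 1) = int (k' * N + r')"
        using N x by simp
      then have e: "x - 1 = k' * N + r'" by (simp only: of_nat_eq_iff)
      have kk: "k' = k" unfolding k_def e using r'(2) by simp
      have rr: "r' = r" unfolding r_def e using r'(2) by simp
      have "p k (v i') = p k (v i)" using kk rr r'(1) pvi by simp
      then have "[v i' = v i] (mod n)" using permk[OF kd] by (simp add: bperm_def)
      then have "i' = i"
        using ex_of[of "\<lambda>i'. [v i' = v i] (mod n)" "v i"] i(1) in'(1) by auto
      moreover from this have "j' = j"
        using row_ex[of k i] k'(2) kk j in'(2) by blast
      ultimately show "q = (i, j)" using ij by simp
    qed
  qed
  have rows: "(\<lambda>i. int (row_sum N A i)) ` {1..N} = (+) K ` range (\<lambda>v. line_total cs (\<lambda>_. v))"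
  proof (intro equalityI subsetI)
    fix s assume "s \<in> (\<lambda>i. int (row_sum N A i)) ` {1..N}"
    then show "s \<in> (+) K ` range (\<lambda>v. line_total cs (\<lambda>_. v))" using row by auto
  next
    fix s assume "s \<in> (+) K ` range (\<lambda>v. line_total cs (\<lambda>_. v))"
    then obtain u where u: "s = K + line_total cs (\<lambda>_. u)" by blast
    obtain i where i: "i \<in> {1..N}" "[v i = u] (mod n)"
      using ex_of[of "\<lambda>i. [v i = u] (mod n)" u] by blast
    have "s = int (row_sum N A i)"
      unfolding u row using i(2) by (subst line_total_cong[OF perm, of _ "\<lambda>_. u"]) auto
    then show "s \<in> (\<lambda>i. int (row_sum N A i)) ` {1..N}" using i(1) by blast
  qed
  have cols: "(\<lambda>j. int (col_sum N A j)) ` {1..N} = (+) K ` range (\<lambda>y. line_total cs (\<lambda>a. y - a))"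
  proof (intro equalityI subsetI)
    fix s assume "s \<in> (\<lambda>j. int (col_sum N A j)) ` {1..N}"
    then show "s \<in> (+) K ` range (\<lambda>y. line_total cs (\<lambda>a. y - a))" using col by auto
  next
    fix s assume "s \<in> (+) K ` range (\<lambda>y. line_total cs (\<lambda>a. y - a))"
    then obtain y where y: "s = K + line_total cs (\<lambda>a. y - a)" by blast
    obtain j where j: "j \<in> {1..N}" "[int j = 2 * y + (m + 1 - \<beta>)] (mod int N)"
      using ex1_residue[OF N0, of "2 * y + (m + 1 - \<beta>)"] by blast
    have "[c j = 2 * y] (mod n)"
    proof -
      have "[c j + (m + 1 - \<beta>) = 2 * y + (m + 1 - \<beta>)] (mod n)"
        using j(2) N by (simp add: c_def)
      then show ?thesis by (simp only: cong_add_rcancel)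
    qed
    then have "[(m + 1) * c j = (m + 1) * (2 * y)] (mod n)"
      by (rule cong_scalar_left)
    moreover have "[(m + 1) * (2 * y) = y] (mod n)"
      using half[of y] by (simp only: mult.left_commute)
    ultimately have "[(m + 1) * c j = y] (mod n)" by (rule cong_trans)
    then have "[(m + 1) * c j - a' = y - a'] (mod n)" for a'
      by (intro cong_diff) simp_all
    then have "s = int (col_sum N A j)"
      unfolding y col by (subst line_total_cong[OF perm, of _ "\<lambda>a. y - a"]) auto
    then show "s \<in> (\<lambda>j. int (col_sum N A j)) ` {1..N}" using j(1) by blast
  qed
  have int_lines: "int ` line_sums N A = (+) K ` {-n..n + 1}"
    unfolding line_sums_def image_Un image_image rows cols totals[symmetric] by (simp add: left right)
  define b where "b = nat (K - n)"
  \<comment> \<open>The least total is attained, so \<open>K - n\<close> is itself a sum of natural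
    numbers and \<open>nat\<close> truncates nothing.\<close>
  have "K - n \<in> int ` line_sums N A"
    unfolding int_lines using n_pos by (intro image_eqI[of _ _ "-n"]) auto
  then have b: "int b = K - n" unfolding b_def by auto
  have "int ` line_sums N A = int ` {b..<b + (2 * N + 2)}"
    unfolding int_lines image_int_atLeastLessThan using b N
    by (auto simp: image_iff intro!: bexI[of _ "_ - K"])
  then have lines: "line_sums N A = {b..<b + (2 * N + 2)}"
    by (simp add: inj_image_eq_iff)
  have "sams N d A"
    unfolding sams_def using d0 dN A_le once lines unfolding d_def by auto
  then show ?thesis
    unfolding regular_sams_def d_def[symmetric]
    using row_card col_card left_card right_card by blast
qed

subsection \<open>Four classes with vanishing line sums\<close>

text \<open>Shift \<open>x\<close> to 0, so that \<open>y\<close> lands on the centred difference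
  \<open>\<delta>\<close>; if \<open>\<delta>\<close> is an end of the block, one further step
  inwards frees it and leaves \<open>x\<close> at distance 1 from 0.\<close>

lemma shift_avoiding_wrap:
  "\<exists>b. \<bar>cen (x + b)\<bar> \<le> m - 3 \<and> \<bar>cen (y + b)\<bar> \<le> m - 1"
proof -
  define \<delta> where "\<delta> = cen (y - x)"
  define s where "s = (if \<delta> = m then -1 else if \<delta> = - m then 1 else 0 :: int)"
  have \<delta>: "\<bar>\<delta>\<bar> \<le> m" unfolding \<delta>_def by (rule cen_abs_le)
  have "[y - x = \<delta>] (mod n)" unfolding \<delta>_def using cen_cong cong_sym by blast
  then have "[(y - x) + s = \<delta> + s] (mod n)" by (simp only: cong_add_rcancel)
  then have "cen ((y - x) + s) = \<delta> + s"
    by (rule cen_eqI) (use \<delta> m_ge in \<open>auto simp: s_def\<close>)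
  then have "cen (y + (s - x)) = \<delta> + s" by (simp add: algebra_simps)
  moreover have "cen (x + (s - x)) = s"
    using m_ge by (simp add: s_def)
  moreover have "\<bar>s\<bar> \<le> m - 3" "\<bar>\<delta> + s\<bar> \<le> m - 1"
    using \<delta> m_ge by (auto simp: s_def)
  ultimately show ?thesis by metis
qed

lemma coprime_half: "coprime (m + 1) n"
proof -
  have "[(m + 1) * 2 = 1] (mod n)" using half[of 1] by (simp add: mult.commute)
  then show ?thesis using coprime_iff_invertible_int by blast
qed

lemma third_mult: "[3 * (t * x) = x] (mod n)"
  using cong_mult[OF third cong_refl[of x]] by (simp add: mult.assoc)

lemma cen_add: "\<bar>cen x + b\<bar> \<le> m \<Longrightarrow> cen (x + b) = cen x + b"
  by (rule cen_eqI) (simp_all add: cong_add_rcancel cong_sym cen_cong)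

text \<open>
  Any \<open>f\<close> gives zero rows and columns. For the linear \<open>f\<close> used here the two diagonal sums are second
  differences over short intervals, so they vanish if \<open>cen\<close> does not jump on these intervals.
\<close>

lemma neutral_quadruple:
  "\<exists>f. bperm f \<and> (let cs = [(a, f), (a + 1, \<lambda>v. - f v), (a + 2, \<lambda>v. - f (v + 2)), (a + 3, \<lambda>v. f (v + 2))] in
     (\<forall>v. line_total cs (\<lambda>_. v) = 0) \<and> (\<forall>y. line_total cs (\<lambda>a. y - a) = 0) \<and>
     line_total cs (\<lambda>a. \<mu> - 2 * a) = 0 \<and> line_total cs (\<lambda>a. t * (\<nu> - 2 * a)) = 0)"
proof -
  \<comment> \<open>\<open>g\<close> is 3/2 modulo \<open>n\<close>: a step of 2 along the left
    diagonal changes \<open>f\<close> by 3, and a step of \<open>2 * t\<close> along the right one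
    by 1. This is why the margins are 3 at \<open>u\<close> and 1 at \<open>q\<close>.\<close>
  define g where "g = 3 * (m + 1)"
  define u where "u = \<mu> - 2 * a - 2"
  define q where "q = t * (\<nu> - 2 * a)"
  obtain b where b: "\<bar>cen (g * u + b)\<bar> \<le> m - 3" "\<bar>cen (g * q + b)\<bar> \<le> m - 1"
    using shift_avoiding_wrap by blast
  define f where "f v = cen (g * v + b)" for v
  have "coprime g n"
    unfolding g_def coprime_mult_left_iff using coprime_3 coprime_half by blast
  then have f: "bperm f"
    unfolding f_def by (rule bperm_affine[OF bperm_of_cen])
  have g2: "[g * (2 * x) = 3 * x] (mod n)" for x
    using cong_scalar_left[OF half[of x], of 3] unfolding g_def by (simp add: algebra_simps)
  have shift: "f v' = f v + s" if "[g * v' = g * v + s] (mod n)" "\<bar>f v + s\<bar> \<le> m" for v v' s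
  proof -
    have "[g * v' + b = (g * v + b) + s] (mod n)"
      using that(1) cong_add_rcancel[of "g * v'" b "g * v + s"] by (simp add: algebra_simps)
    then have "f v' = cen ((g * v + b) + s)" unfolding f_def by (simp add: cen_eq_iff)
    then show ?thesis using cen_add that(2) unfolding f_def by simp
  qed
  have up: "f (u + 2) = f u + 3"
    by (rule shift) (use g2[of 1] b(1) in \<open>auto simp: f_def distrib_left cong_add_lcancel\<close>)
  have dn: "f (u - 2) = f u - 3"
    using shift[of "u - 2" u "-3"] g2[of "-1"] b(1)
    by (auto simp: f_def right_diff_distrib cong_iff_dvd_diff)
  have g2t: "[g * (2 * (t * x)) = x] (mod n)" for x
    using g2[of "t * x"] third_mult[of x] cong_trans by blast
  have q1: "f (q - 2 * t) = f q - 1"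
  proof -
    have "[g * (q - 2 * t) = g * q + - 1] (mod n)"
      using g2t[of "-1"] by (simp add: cong_iff_dvd_diff algebra_simps)
    then show ?thesis using shift[of "q - 2 * t" q "-1"] b(2) by (auto simp: f_def)
  qed
  have q2: "f (q - 4 * t + 2) = f q + 1"
  proof -
    \<comment> \<open>As \<open>3 * t\<close> is 1, moving by \<open>2 - 4 * t\<close> amounts to
      moving by \<open>2 * t\<close>.\<close>
    have "[g * (2 * (1 - 2 * t)) = g * (2 * (t * 1))] (mod n)"
    proof -
      have "[1 - 2 * t = t] (mod n)"
        using third by (simp add: cong_iff_dvd_diff dvd_diff_commute algebra_simps)
      then show ?thesis by (intro cong_scalar_left) simp
    qed
    then have "[g * (2 * (1 - 2 * t)) = 1] (mod n)" using g2t[of 1] cong_trans by blast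
    then have "[g * (q - 4 * t + 2) = g * q + 1] (mod n)"
      by (simp add: cong_iff_dvd_diff algebra_simps)
    then show ?thesis using shift[of "q - 4 * t + 2" q 1] b(2) by (auto simp: f_def)
  qed
  have q3: "f (q - 6 * t + 2) = f q"
  proof (rule bpermD[OF f])
    have "[q + 2 - 2 * (3 * t) = q + 2 - 2 * 1] (mod n)"
      using third by (intro cong_diff cong_scalar_left) simp_all
    then show "[q - 6 * t + 2 = q] (mod n)" by (simp add: algebra_simps)
  qed
  have L: "\<mu> - 2 * a = u + 2" "\<mu> - 2 * (a + 1) = u" "\<mu> - 2 * (a + 2) + 2 = u" "\<mu> - 2 * (a + 3) + 2 = u - 2"
    unfolding u_def by simp_all
  have D: "t * (\<nu> - 2 * a) = q" "t * (\<nu> - 2 * (a + 1)) = q - 2 * t"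
    "t * (\<nu> - 2 * (a + 2)) + 2 = q - 4 * t + 2" "t * (\<nu> - 2 * (a + 3)) + 2 = q - 6 * t + 2"
    unfolding q_def by (simp_all add: algebra_simps)
  have col: "y - (a + 2) + 2 = y - a" "y - (a + 3) + 2 = y - (a + 1)" for y by simp_all
  show ?thesis
    by (intro exI[of _ f] conjI f, unfold Let_def, intro conjI allI;
        unfold line_total_simps L D col) (simp_all add: up dn q1 q2 q3)
qed

text \<open>All class numbers stay in a window of length at most \<open>n\<close>, hence are distinct modulo \<open>n\<close>.\<close>

definition window_classes :: "int \<Rightarrow> int \<Rightarrow> (int \<times> (int \<Rightarrow> int)) list \<Rightarrow> bool" where
  "window_classes lo hi cs \<longleftrightarrow>
     distinct (map fst cs) \<and> fst ` set cs \<subseteq> {lo..hi} \<and> (\<forall>(a, p)\<in>set cs. bperm p)"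

text \<open>Each quadruple takes the four class numbers just above the window and so meets no
  earlier class. Its \<open>f\<close> depends on the diagonals, hence \<open>\<mu>\<close> and
  \<open>\<nu>\<close> are fixed in advance.\<close>

lemma add_quadruples:
  assumes "window_classes lo hi cs" "lo \<le> hi"
  shows "\<exists>ds. window_classes lo (hi + 4 * int b) ds \<and> length ds = length cs + 4 * b \<and>
    (\<forall>v. line_total ds (\<lambda>_. v) = line_total cs (\<lambda>_. v)) \<and>
    (\<forall>y. line_total ds (\<lambda>a. y - a) = line_total cs (\<lambda>a. y - a)) \<and>
    line_total ds (\<lambda>a. \<mu> - 2 * a) = line_total cs (\<lambda>a. \<mu> - 2 * a) \<and>
    line_total ds (\<lambda>a. t * (\<nu> - 2 * a)) = line_total cs (\<lambda>a. t * (\<nu> - 2 * a))"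
proof (induction b)
  case 0
  show ?case using assms by (intro exI[of _ cs]) simp
next
  case (Suc b)
  then obtain ds where ds: "window_classes lo (hi + 4 * int b) ds" "length ds = length cs + 4 * b"
    "\<forall>v. line_total ds (\<lambda>_. v) = line_total cs (\<lambda>_. v)"
    "\<forall>y. line_total ds (\<lambda>a. y - a) = line_total cs (\<lambda>a. y - a)"
    "line_total ds (\<lambda>a. \<mu> - 2 * a) = line_total cs (\<lambda>a. \<mu> - 2 * a)"
    "line_total ds (\<lambda>a. t * (\<nu> - 2 * a)) = line_total cs (\<lambda>a. t * (\<nu> - 2 * a))"
    by blast
  define c where "c = hi + 4 * int b + 1"
  obtain f where f: "bperm f" and q: "let qs = [(c, f), (c + 1, \<lambda>v. - f v), (c + 2, \<lambda>v. - f (v + 2)), (c + 3, \<lambda>v. f (v + 2))] in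
     (\<forall>v. line_total qs (\<lambda>_. v) = 0) \<and> (\<forall>y. line_total qs (\<lambda>a. y - a) = 0) \<and>
     line_total qs (\<lambda>a. \<mu> - 2 * a) = 0 \<and> line_total qs (\<lambda>a. t * (\<nu> - 2 * a)) = 0"
    using neutral_quadruple by blast
  define qs where "qs = [(c, f), (c + 1, \<lambda>v. - f v), (c + 2, \<lambda>v. - f (v + 2)), (c + 3, \<lambda>v. f (v + 2))]"
  note q = q[folded qs_def, unfolded Let_def]
  have "window_classes lo (hi + 4 * int (Suc b)) (ds @ qs)"
    using ds(1) bperm_shift[OF f] bperm_uminus[OF f] bperm_uminus[OF bperm_shift[OF f]] f assms
    unfolding window_classes_def qs_def c_def by (fastforce simp: image_subset_iff)
  then show ?case
    using q ds by (intro exI[of _ "ds @ qs"]) (simp add: qs_def)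
qed

subsection \<open>Twisting classes\<close>

text \<open>The sign condition makes \<open>H\<close> permute \<open>{1..m}\<close> and
  \<open>{-m..0}\<close> separately, so that subtracting \<open>H\<close> from \<open>m + 1\<close>
  on the first set and from \<open>-m\<close> on the second stays inside each set.\<close>

definition admissible :: "(int \<Rightarrow> int) \<Rightarrow> bool" where
  "admissible H \<longleftrightarrow> inj_on H {-m..m} \<and> (\<forall>w. \<bar>w\<bar> \<le> m \<longrightarrow> \<bar>H w\<bar> \<le> m \<and> (0 < H w \<longleftrightarrow> 0 < w))"

text \<open>The diagonals see \<open>H\<close> at a few points only. A sign-respecting injective
  prescription there is completed independently on \<open>{1..m}\<close> and on
  \<open>{-m..0}\<close>.\<close>

lemma admissible_extension:
  assumes "distinct (map fst ps)" "distinct (map snd ps)"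
    and ps: "\<forall>(w, x)\<in>set ps. \<bar>w\<bar> \<le> m \<and> \<bar>x\<bar> \<le> m \<and> (0 < x \<longleftrightarrow> 0 < w)"
  shows "\<exists>H. admissible H \<and> (\<forall>(w, x)\<in>set ps. H w = x)"
proof -
  define f where "f w = the (map_of ps w)" for w
  have f: "f w = x" if "(w, x) \<in> set ps" for w x
    using that assms(1) by (simp add: f_def)
  have inj: "inj_on f (fst ` set ps)"
  proof (rule inj_onI)
    fix w w' assume "w \<in> fst ` set ps" "w' \<in> fst ` set ps" "f w = f w'"
    then obtain x where x: "(w, x) \<in> set ps" "(w', x) \<in> set ps" using f by fastforce
    then show "w = w'"
      using assms(2) by (metis distinct_map inj_onD prod.inject snd_conv)
  qed
  have ext: "\<exists>g. bij_betw g A A \<and> (\<forall>w\<in>fst ` set ps \<inter> A. g w = f w)"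
    if "A = {1..m} \<or> A = {-m..0}" for A
  proof (rule extend_injection)
    show "inj_on f (fst ` set ps \<inter> A)" using inj by (rule inj_on_subset) blast
    show "f ` (fst ` set ps \<inter> A) \<subseteq> A" using that ps f by fastforce
  qed (use that in auto)
  obtain g where g: "bij_betw g {1..m} {1..m}" "\<forall>w\<in>fst ` set ps \<inter> {1..m}. g w = f w"
    using ext[of "{1..m}"] by blast
  obtain k where k: "bij_betw k {-m..0} {-m..0}" "\<forall>w\<in>fst ` set ps \<inter> {-m..0}. k w = f w"
    using ext[of "{-m..0}"] by blast
  define H where "H w = (if 0 < w then g w else k w)" for w
  have Hpos: "H w \<in> {1..m}" if "w \<in> {1..m}" for w
    using bij_betwE[OF g(1)] that unfolding H_def by auto
  have Hneg: "H w \<in> {-m..0}" if "w \<in> {-m..0}" for w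
    using bij_betwE[OF k(1)] that unfolding H_def by auto
  have range: "\<bar>H w\<bar> \<le> m \<and> (0 < H w \<longleftrightarrow> 0 < w)" if "\<bar>w\<bar> \<le> m" for w
    using Hpos[of w] Hneg[of w] that by (cases "0 < w") auto
  have "inj_on H {-m..m}"
  proof (rule inj_onI)
    fix w w' assume w: "w \<in> {-m..m}" "w' \<in> {-m..m}" "H w = H w'"
    then have "0 < w \<longleftrightarrow> 0 < w'" using range[of w] range[of w'] by auto
    then show "w = w'"
      using w g(1) k(1) unfolding H_def bij_betw_def inj_on_def by (auto split: if_splits)
  qed
  moreover have "H w = x" if "(w, x) \<in> set ps" for w x
  proof -
    have "w \<in> fst ` set ps" "\<bar>w\<bar> \<le> m" using that ps by force+
    then have "H w = f w" using g(2) k(2) unfolding H_def by auto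
    then show ?thesis using f[OF that] by simp
  qed
  ultimately show ?thesis
    using range unfolding admissible_def by blast
qed

text \<open>
  The two functions \<open>f' = low H\<close> and \<open>f = high H\<close> of the twist: their difference is \<open>m + 1\<close> on the
  residues \<open>1, \<dots>, m\<close> and \<open>-m\<close> elsewhere, so its own differences vanish except at two places.
\<close>

definition low :: "(int \<Rightarrow> int) \<Rightarrow> int \<Rightarrow> int" where
  "low H w = - H (cen w)"

definition high :: "(int \<Rightarrow> int) \<Rightarrow> int \<Rightarrow> int" where
  "high H w = (if 0 < cen w then m + 1 else - m) - H (cen w)"

lemma cen_range: "cen v \<in> {-m..m}"
  using cen_abs_le[of v] by (auto simp: abs_le_iff)

lemma admissible_cen:
  assumes "admissible H"
  shows "H (cen u) = H (cen v) \<longleftrightarrow> [u = v] (mod n)"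
    and "\<bar>H (cen v)\<bar> \<le> m" and "0 < H (cen v) \<longleftrightarrow> 0 < cen v"
proof -
  have "inj_on H {-m..m}" using assms by (simp add: admissible_def)
  then show "H (cen u) = H (cen v) \<longleftrightarrow> [u = v] (mod n)"
    using inj_on_eq_iff[OF _ cen_range cen_range] cen_eq_iff by blast
qed (use assms cen_abs_le in \<open>auto simp: admissible_def\<close>)

lemma bperm_low: "admissible H \<Longrightarrow> bperm (low H)"
  by (simp add: bperm_def low_def admissible_cen)

text \<open>The sign of \<open>high H v\<close> agrees with that of \<open>cen v\<close> and thus
  reveals the branch; within a branch injectivity is that of \<open>H\<close>.\<close>

lemma bperm_high:
  assumes "admissible H"
  shows "bperm (high H)"
proof -
  note H = admissible_cen[OF assms]
  have pos: "0 < high H v \<longleftrightarrow> 0 < cen v" and bound: "\<bar>high H v\<bar> \<le> m" for v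
    using H(2,3)[of v] unfolding high_def by auto
  have "high H u = high H v \<longleftrightarrow> [u = v] (mod n)" for u v
  proof
    assume eq: "high H u = high H v"
    then have "0 < cen u \<longleftrightarrow> 0 < cen v" using pos by metis
    then have "H (cen u) = H (cen v)" using eq unfolding high_def by (auto split: if_splits)
    then show "[u = v] (mod n)" by (simp add: H(1))
  next
    assume "[u = v] (mod n)"
    then show "high H u = high H v" unfolding high_def by (simp flip: cen_eq_iff)
  qed
  then show ?thesis using bound unfolding bperm_def by blast
qed

text \<open>The column correction: the backward difference of \<open>high H - low H\<close>, nonzero
  only where the difference switches between \<open>-m\<close> and \<open>m + 1\<close>.\<close>

definition jump :: "int \<Rightarrow> int" where
  "jump w = (if cen w = 1 then n else if cen w = - m then - n else 0)"

lemma cen_pred: "cen (w - 1) = (if cen w = - m then m else cen w - 1)"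
proof (rule cen_eqI)
  have *: "[w - 1 = cen w - 1] (mod n)"
    using cong_sym[OF cen_cong] by (intro cong_diff) simp_all
  show "[w - 1 = (if cen w = - m then m else cen w - 1)] (mod n)"
  proof (cases "cen w = - m")
    case True
    have "[- m - 1 = m] (mod n)"
      unfolding n_eq cong_iff_dvd_diff by (intro dvdI[of _ _ "-1"]) simp
    then show ?thesis using * True cong_trans by simp
  qed (use * in simp)
qed (use cen_abs_le[of w] m_ge in \<open>auto simp: abs_le_iff\<close>)

lemma high_minus_low: "(high H w - low H w) - (high H (w - 1) - low H (w - 1)) = jump w"
  using m_ge n_eq cen_abs_le[of w] unfolding high_def low_def jump_def cen_pred by auto

text \<open>The two classes of a pair carry opposite functions of the row, so rows cancel. In column
  \<open>y\<close> they are evaluated at \<open>w = q * (y + r)\<close> and, as \<open>q * s\<close>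
  is to be 1, at \<open>w - 1\<close>: the total is the difference of \<open>high H - low H\<close>,
  whatever \<open>a\<close> and \<open>b\<close> are.\<close>

definition twist4 where
  "twist4 H q r s a b =
    [(a, \<lambda>v. high H (q * (v + a + r))), (a + s, \<lambda>v. - high H (q * (v + a + r))),
     (b, \<lambda>v. - low H (q * (v + b + r))), (b + s, \<lambda>v. low H (q * (v + b + r)))]"

text \<open>Here the \<open>low\<close> part uses two pairs. In a column they contribute
  \<open>low\<close> at \<open>w - 1\<close> and \<open>- low\<close> at \<open>w\<close>, and their
  other two terms cancel at the common argument \<open>q * (y - b' + c' + r)\<close>.\<close>

definition twist6 where
  "twist6 H q r s a b b' c' =
    [(a, \<lambda>v. high H (q * (v + a + r))), (a + s, \<lambda>v. - high H (q * (v + a + r))),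
     (b, \<lambda>v. low H (q * (v + b - s + r))), (b + b' - c' - s, \<lambda>v. - low H (q * (v + b - s + r))),
     (b', \<lambda>v. low H (q * (v + c' + r))), (c', \<lambda>v. - low H (q * (v + c' + r)))]"

lemma twist_row:
  "line_total (twist4 H q r s a b) (\<lambda>_. v) = 0"
  "line_total (twist6 H q r s a b b' c') (\<lambda>_. v) = 0"
  by (simp_all add: twist4_def twist6_def)

lemma twist_col:
  assumes "admissible H" "[q * s = 1] (mod n)"
  shows "line_total (twist4 H q r s a b) (\<lambda>x. y - x) = jump (q * (y + r))"
    and "line_total (twist6 H q r s a b b' c') (\<lambda>x. y - x) = jump (q * (y + r))"
proof -
  have "[q * (y - s + r) = q * (y + r) - 1] (mod n)"
    using cong_diff[OF cong_refl[of "q * (y + r)"] assms(2)] by (simp add: algebra_simps)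
  then have e: "high H (q * (y - s + r)) = high H (q * (y + r) - 1)"
      "low H (q * (y - s + r)) = low H (q * (y + r) - 1)"
    using bpermD bperm_high bperm_low assms(1) by blast+
  have i: "y - a + a + r = y + r" "y - (a + s) + a + r = y - s + r"
      "y - b + b + r = y + r" "y - (b + s) + b + r = y - s + r"
      "y - b + b - s + r = y - s + r"
      "y - (b + b' - c' - s) + b - s + r = y - b' + c' + r" "y - c' + c' + r = y + r"
    by simp_all
  show "line_total (twist4 H q r s a b) (\<lambda>x. y - x) = jump (q * (y + r))"
    using high_minus_low[of H "q * (y + r)"] unfolding twist4_def line_total_simps i e by simp
  show "line_total (twist6 H q r s a b b' c') (\<lambda>x. y - x) = jump (q * (y + r))"
    using high_minus_low[of H "q * (y + r)"] unfolding twist6_def line_total_simps i e by simp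
qed

lemma bperm_twist:
  assumes "admissible H" "coprime q n"
  shows "\<forall>(x, p)\<in>set (twist4 H q r s a b). bperm p"
    and "\<forall>(x, p)\<in>set (twist6 H q r s a b b' c'). bperm p"
proof -
  have "bperm (\<lambda>v. high H (q * (v + x)))" "bperm (\<lambda>v. low H (q * (v + x)))" for x
    using bperm_affine[OF bperm_high[OF assms(1)] assms(2), of "q * x"]
      bperm_affine[OF bperm_low[OF assms(1)] assms(2), of "q * x"] by (simp_all add: distrib_left)
  from this this[THEN bperm_uminus] show
    "\<forall>(x, p)\<in>set (twist4 H q r s a b). bperm p" "\<forall>(x, p)\<in>set (twist6 H q r s a b b' c'). bperm p"
    unfolding twist4_def twist6_def by (simp_all add: add.assoc add_diff_eq[symmetric] diff_add_eq)
qed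

subsection \<open>Skeletons\<close>

text \<open>
  The even skeleton has the row sums \<open>-(n - 1), \<dots>, -2, 0, 2, \<dots>, n - 1\<close>, the odd numbers between as
  column sums and one more column sum 0. The odd skeleton has the column sums \<open>-m, \<dots>, m\<close> and the row
  sums 0 and \<open>\<plusminus>(m + 1), \<dots>, \<plusminus>(n - 1)\<close>.
\<close>

definition even_skeleton :: "(int \<times> (int \<Rightarrow> int)) list" where
  "even_skeleton = [(0, cen), (1, cen)]"

definition odd_skeleton :: "(int \<times> (int \<Rightarrow> int)) list" where
  "odd_skeleton = [(-1, \<lambda>v. cen ((m + 1) * (v - 1))), (0, \<lambda>v. - cen ((m + 1) * v)), (1, \<lambda>v. cen ((m + 1) * (v + 1)))]"

lemma bperm_skeleton:
  "\<forall>(x, p)\<in>set even_skeleton. bperm p" "\<forall>(x, p)\<in>set odd_skeleton. bperm p"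
proof -
  have "bperm (\<lambda>v. cen ((m + 1) * (v + x)))" for x
    using bperm_affine[OF bperm_of_cen coprime_half, of "(m + 1) * x"] by (simp add: distrib_left)
  from this[of "-1"] this[of 0] this[of 1] bperm_uminus[OF this[of 0]] show
    "\<forall>(x, p)\<in>set even_skeleton. bperm p" "\<forall>(x, p)\<in>set odd_skeleton. bperm p"
    by (simp_all add: even_skeleton_def odd_skeleton_def bperm_of_cen)
qed

lemma range_cen: "range (\<lambda>v. f (cen v)) = f ` {-m..m}"
proof -
  have "range cen = {-m..m}"
  proof (intro equalityI subsetI)
    fix x assume "x \<in> {-m..m}"
    then have "cen x = x" by (intro cen_small) (auto simp: abs_le_iff)
    then show "x \<in> range cen" by (metis rangeI)
  qed (use cen_abs_le in \<open>auto simp: abs_le_iff\<close>, smt (verit) cen_abs_le)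
  then show ?thesis by (simp add: image_comp[symmetric] flip: image_image)
qed

text \<open>Rows give the even numbers from \<open>- 2 * m\<close> to \<open>2 * m\<close>;
  corrected columns give the odd ones from \<open>- n\<close> to \<open>n - 2\<close>, with 1
  replaced by \<open>n + 1\<close>. Exactly 1 and \<open>n\<close> are left for the
  diagonals.\<close>

lemma even_totals:
  assumes ld: "{l, d} = {1, n}"
    and row: "\<And>v. line_total cs (\<lambda>_. v) = 0"
    and col: "\<And>y. line_total cs (\<lambda>a. y - a) = jump y"
  shows "range (\<lambda>v. line_total (even_skeleton @ cs) (\<lambda>_. v)) \<union>
    range (\<lambda>y. line_total (even_skeleton @ cs) (\<lambda>a. y - a)) \<union> {l, d} = {-n..n + 1}"
proof -
  have "line_total (even_skeleton @ cs) (\<lambda>_. v) = 2 * cen v" for v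
    by (simp add: even_skeleton_def row)
  then have r: "range (\<lambda>v. line_total (even_skeleton @ cs) (\<lambda>_. v)) = (\<lambda>c. 2 * c) ` {-m..m}"
    using range_cen[of "\<lambda>c. 2 * c"] by simp
  \<comment> \<open>At residue \<open>-m\<close> the skeleton wraps and gives 0, which the jump
    turns into \<open>-n = 2 * (-m) - 1\<close>; so only residue 1 is exceptional.\<close>
  have "line_total (even_skeleton @ cs) (\<lambda>a. y - a) = (if cen y = 1 then n + 1 else 2 * cen y - 1)" for y
  proof -
    have "line_total (even_skeleton @ cs) (\<lambda>a. y - a) = cen y + cen (y - 1) + jump y"
      by (simp add: even_skeleton_def col)
    then show ?thesis using m_ge n_eq unfolding jump_def cen_pred by auto
  qed
  then have c: "range (\<lambda>y. line_total (even_skeleton @ cs) (\<lambda>a. y - a)) =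
      (\<lambda>c. if c = 1 then n + 1 else 2 * c - 1) ` {-m..m}"
    using range_cen[of "\<lambda>c. if c = 1 then n + 1 else 2 * c - 1"] by simp
  show ?thesis
    unfolding r c ld
  proof (intro equalityI subsetI)
    fix x assume x: "x \<in> {-n..n + 1}"
    have "- n \<le> x" "x \<le> n + 1" using x by auto
    then have "x = 1 \<or> x = n \<or> x = n + 1 \<or> even x \<and> - (2 * m) \<le> x \<and> x \<le> 2 * m \<or>
        odd x \<and> x \<noteq> 1 \<and> - n \<le> x \<and> x < n"
      unfolding n_eq by presburger
    then consider "x = 1" | "x = n" | "x = n + 1" | "even x" "- (2 * m) \<le> x" "x \<le> 2 * m"
      | "odd x" "x \<noteq> 1" "- n \<le> x" "x < n"
      by blast
    then show "x \<in> (\<lambda>c. 2 * c) ` {-m..m} \<union> (\<lambda>c. if c = 1 then n + 1 else 2 * c - 1) ` {-m..m} \<union> {1, n}"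
    proof cases
      case 3
      then show ?thesis using m_ge by (intro UnI1 UnI2 image_eqI[of _ _ 1]) auto
    next
      case 4
      then show ?thesis by (intro UnI1 image_eqI[of _ _ "x div 2"]) auto
    next
      case 5
      then obtain e where "x = 2 * e + 1" by (elim oddE)
      then show ?thesis using 5 n_eq by (intro UnI1 UnI2 image_eqI[of _ _ "e + 1"]) auto
    qed auto
  qed (use m_ge n_eq in \<open>auto split: if_splits\<close>)
qed

text \<open>Moving \<open>v\<close> by 1 moves \<open>h * v\<close> by a half, which can be
  represented by \<open>m + 1\<close> or \<open>-m\<close>; the sign of \<open>cen (h * v)\<close>
  selects the one that stays in the block.\<close>

lemma cen_half_offsets:
  defines "h \<equiv> m + 1"
  shows "cen (h * (v + 1)) = (if 0 \<le> cen (h * v) then cen (h * v) - m else cen (h * v) + m + 1)"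
    and "cen (h * (v - 1)) = (if 0 < cen (h * v) then cen (h * v) - m - 1 else cen (h * v) + m)"
proof -
  have c: "[h * v + x = cen (h * v) + x] (mod n)" for x
    using cong_sym[OF cen_cong] by (simp only: cong_add_rcancel)
  have "[cen (h * v) + h = cen (h * v) - m] (mod n)" "[cen (h * v) - h = cen (h * v) + m] (mod n)"
    unfolding cong_iff_dvd_diff h_def n_eq
    by (intro dvdI[of _ _ 1], simp) (intro dvdI[of _ _ "-1"], simp)
  then have "[h * (v + 1) = (if 0 \<le> cen (h * v) then cen (h * v) - m else cen (h * v) + m + 1)] (mod n)"
    "[h * (v - 1) = (if 0 < cen (h * v) then cen (h * v) - m - 1 else cen (h * v) + m)] (mod n)"
  proof -
    assume *: "[cen (h * v) + h = cen (h * v) - m] (mod n)" "[cen (h * v) - h = cen (h * v) + m] (mod n)"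
    have "[h * (v + 1) = cen (h * v) + h] (mod n)" "[h * (v - 1) = cen (h * v) - h] (mod n)"
      using c[of h] c[of "-h"] by (simp_all add: distrib_left right_diff_distrib)
    then show "[h * (v + 1) = (if 0 \<le> cen (h * v) then cen (h * v) - m else cen (h * v) + m + 1)] (mod n)"
      "[h * (v - 1) = (if 0 < cen (h * v) then cen (h * v) - m - 1 else cen (h * v) + m)] (mod n)"
      using *[THEN cong_trans[rotated]] by (auto simp: h_def diff_diff_eq add.assoc)
  qed
  then show "cen (h * (v + 1)) = (if 0 \<le> cen (h * v) then cen (h * v) - m else cen (h * v) + m + 1)"
    "cen (h * (v - 1)) = (if 0 < cen (h * v) then cen (h * v) - m - 1 else cen (h * v) + m)"
    using cen_abs_le[of "h * v"] by (auto intro!: cen_eqI)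
qed

text \<open>With \<open>w\<close> a quarter of \<open>y + 2\<close>, twice \<open>w\<close> is
  \<open>y / 2 + 1\<close> modulo \<open>n\<close>. So \<open>w = 1\<close> and
  \<open>w = -m\<close> occur where the half of \<open>y\<close> is 1 and 0, exactly the column sums
  to be corrected.\<close>

lemma jump_quarter:
  "jump ((m + 1) * (m + 1) * (y + 2)) = (if cen ((m + 1) * y) = 1 then n else if cen ((m + 1) * y) = 0 then - n else 0)"
proof -
  define w where "w = (m + 1) * (m + 1) * (y + 2)"
  have w2: "[2 * w = (m + 1) * y + 1] (mod n)"
  proof -
    have "[2 * w = (m + 1) * (y + 2)] (mod n)"
      using half[of "(m + 1) * (y + 2)"] by (simp add: w_def mult.assoc)
    moreover have "[(m + 1) * (y + 2) = (m + 1) * y + 1] (mod n)"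
      using half[of 1] by (simp add: distrib_left cong_add_lcancel mult.commute)
    ultimately show ?thesis by (rule cong_trans)
  qed
  have key: "cen w = x \<longleftrightarrow> cen ((m + 1) * y) = z" if "\<bar>x\<bar> \<le> m" "\<bar>z\<bar> \<le> m" "[2 * x = z + 1] (mod n)" for x z
  proof -
    have "cen w = x \<longleftrightarrow> cen w = cen x" using that(1) by simp
    also have "\<dots> \<longleftrightarrow> [w = x] (mod n)" by (rule cen_eq_iff)
    also have "\<dots> \<longleftrightarrow> [2 * w = 2 * x] (mod n)" using coprime_2 by (simp add: cong_mult_lcancel)
    also have "\<dots> \<longleftrightarrow> [(m + 1) * y + 1 = z + 1] (mod n)"
      using w2 that(3) by (meson cong_sym cong_trans)
    also have "\<dots> \<longleftrightarrow> [(m + 1) * y = z] (mod n)" by (simp only: cong_add_rcancel)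
    also have "\<dots> \<longleftrightarrow> cen ((m + 1) * y) = cen z" by (rule cen_eq_iff[symmetric])
    finally show ?thesis using that(2) by simp
  qed
  have "[2 * (- m) = 0 + 1] (mod n)"
    unfolding cong_iff_dvd_diff n_eq by (intro dvdI[of _ _ "-1"]) simp
  then show ?thesis
    using key[of 1 1] key[of "-m" 0] m_ge unfolding jump_def w_def by auto
qed

text \<open>In terms of the centred half \<open>c\<close>, a row gives \<open>c - n\<close>, 0 or
  \<open>c + n\<close> by the sign of \<open>c\<close>, and a column gives \<open>c\<close> except
  that 1 and 0 become \<open>n + 1\<close> and \<open>- n\<close>. The row sum 0 replaces the lost
  column sum 0.\<close>

lemma odd_totals:
  assumes ld: "{l, d} = {1, n}"
    and row: "\<And>v. line_total cs (\<lambda>_. v) = 0"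
    and col: "\<And>y. line_total cs (\<lambda>a. y - a) = jump ((m + 1) * (m + 1) * (y + 2))"
  shows "range (\<lambda>v. line_total (odd_skeleton @ cs) (\<lambda>_. v)) \<union>
    range (\<lambda>y. line_total (odd_skeleton @ cs) (\<lambda>a. y - a)) \<union> {l, d} = {-n..n + 1}"
proof -
  let ?r = "\<lambda>c. if 0 < c then c - n else if c = 0 then 0 else c + n"
  let ?c = "\<lambda>c. if c = 1 then n + 1 else if c = 0 then - n else c"
  have half_range: "range (\<lambda>v. f (cen ((m + 1) * v))) = f ` {-m..m}" for f :: "int \<Rightarrow> int"
  proof -
    have "cen v = cen ((m + 1) * (2 * v))" for v
      using half[of v] by (simp add: cen_eq_iff cong_sym_eq mult.left_commute)
    then have "range cen = range (\<lambda>v. cen ((m + 1) * v))" by (fastforce simp: image_iff)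
    then show ?thesis using range_cen[of f] by (metis image_image)
  qed
  have "line_total (odd_skeleton @ cs) (\<lambda>_. v) = ?r (cen ((m + 1) * v))" for v
  proof -
    have "line_total (odd_skeleton @ cs) (\<lambda>_. v) =
        cen ((m + 1) * (v - 1)) - cen ((m + 1) * v) + cen ((m + 1) * (v + 1))"
      by (simp add: odd_skeleton_def row)
    then show ?thesis unfolding cen_half_offsets using n_eq by auto
  qed
  then have r: "range (\<lambda>v. line_total (odd_skeleton @ cs) (\<lambda>_. v)) = ?r ` {-m..m}"
    using half_range[of ?r] by simp
  have "line_total (odd_skeleton @ cs) (\<lambda>a. y - a) = ?c (cen ((m + 1) * y))" for y
    by (simp add: odd_skeleton_def col jump_quarter)
  then have c: "range (\<lambda>y. line_total (odd_skeleton @ cs) (\<lambda>a. y - a)) = ?c ` {-m..m}"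
    using half_range[of ?c] by simp
  show ?thesis
    unfolding r c ld
  proof (intro equalityI subsetI)
    fix x assume x: "x \<in> {-n..n + 1}"
    consider "x = 0" | "x = 1" | "x = n" | "x = n + 1" | "x = - n" | "x \<noteq> 0" "x \<noteq> 1" "\<bar>x\<bar> \<le> m"
      | "m < x" "x < n" | "- n < x" "x < - m"
      using x by fastforce
    then show "x \<in> ?r ` {-m..m} \<union> ?c ` {-m..m} \<union> {1, n}"
    proof cases
      case 1
      then show ?thesis using m_ge by (intro UnI1 image_eqI[of _ _ 0]) auto
    next
      case 4
      then show ?thesis using m_ge by (intro UnI1 UnI2 image_eqI[of _ _ 1]) auto
    next
      case 5
      then show ?thesis using m_ge by (intro UnI1 UnI2 image_eqI[of _ _ 0]) auto
    next
      case 6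
      then show ?thesis by (intro UnI1 UnI2 image_eqI[of _ _ x]) auto
    next
      case 7
      then show ?thesis using n_eq by (intro UnI1 image_eqI[of _ _ "x - n"]) auto
    next
      case 8
      then show ?thesis using n_eq by (intro UnI1 image_eqI[of _ _ "x + n"]) auto
    qed auto
  qed (use m_ge n_eq in \<open>auto split: if_splits\<close>)
qed

subsection \<open>Diagonal sums of the basic configurations\<close>

text \<open>Listing the possible multiples of \<open>n\<close> turns the evaluation of
  \<open>cen\<close> at an argument depending on \<open>l\<close> into linear arithmetic.\<close>

lemma cen_near:
  assumes "w - v \<in> {0, n, - n, 2 * n, - 2 * n, 3 * n, - 3 * n, 4 * n, - 4 * n}" "\<bar>w\<bar> \<le> m"
  shows "cen v = w"
proof (rule cen_eqI)
  have "n dvd w - v" using assms(1) by auto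
  then show "[v = w] (mod n)" by (simp add: cong_iff_dvd_diff dvd_diff_commute)
qed (rule assms(2))

lemma cen_half_near:
  assumes "2 * w - v \<in> {0, n, - n, 2 * n, - 2 * n, 3 * n, - 3 * n, 4 * n, - 4 * n, 5 * n, - 5 * n}"
    and "\<bar>w\<bar> \<le> m"
  shows "cen ((m + 1) * v) = w"
proof (rule cen_eqI)
  have "n dvd 2 * w - v" using assms(1) by auto
  then have "[2 * w = v] (mod n)" by (simp add: cong_iff_dvd_diff)
  then have "[2 * ((m + 1) * v) = 2 * w] (mod n)"
    using half[of v] by (meson cong_sym cong_trans)
  then show "[(m + 1) * v = w] (mod n)"
    using coprime_2 by (simp only: cong_mult_lcancel)
qed (rule assms(2))

text \<open>The odd configurations apply this to even \<open>v\<close>; as \<open>n\<close> is odd,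
  only even multiples of \<open>n\<close> arise.\<close>

lemma cen_quarter_near:
  assumes "4 * w - v \<in> {0, 2 * n, - 2 * n, 4 * n, - 4 * n, 6 * n, - 6 * n, 8 * n, - 8 * n, 10 * n, - 10 * n}"
    and "\<bar>w\<bar> \<le> m"
  shows "cen ((m + 1) * (m + 1) * v) = w"
proof (rule cen_eqI)
  have "n dvd 4 * w - v" using assms(1) by auto
  then have "[2 * (2 * w) = v] (mod n)" by (simp add: cong_iff_dvd_diff)
  then have "[2 * (2 * w) = 2 * ((m + 1) * v)] (mod n)"
    using half[of v] by (meson cong_sym cong_trans)
  then have "[2 * w = (m + 1) * v] (mod n)"
    using coprime_2 by (simp only: cong_mult_lcancel)
  then have "[2 * ((m + 1) * ((m + 1) * v)) = 2 * w] (mod n)"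
    using half[of "(m + 1) * v"] by (meson cong_sym cong_trans)
  then show "[(m + 1) * (m + 1) * v = w] (mod n)"
    using coprime_2 unfolding mult.assoc by (simp only: cong_mult_lcancel)
qed (rule assms(2))

text \<open>
  The class numbers and the values of \<open>H\<close> at the few relevant points were found by a computer search.
\<close>

lemma diagonals_6_mod_1:
  assumes a: "n = 6 * l + 1" "t = - 2 * l" "2 \<le> l"
  shows "\<exists>H. admissible H \<and>
    {line_total (even_skeleton @ twist4 H 1 0 1 2 4) (\<lambda>a. 3 - 2 * a),
     line_total (even_skeleton @ twist4 H 1 0 1 2 4) (\<lambda>a. t * (1 - 2 * a))} = {1, n}"
proof -
  have m: "m = 3 * l" using a n_eq by simp
  \<comment> \<open>The first components are all the points at which the two diagonals evaluate
    \<open>H\<close>; the second ones are the values prescribed there.\<close>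
  let ?ps = "[(1, m), (- 1, - 1), (- 3, - m + 2), (- 2 * l, - 2), (2 * l + 2, 2)] :: (int \<times> int) list"
  have "distinct (map fst ?ps)" "distinct (map snd ?ps)"
    "\<forall>(w, x)\<in>set ?ps. \<bar>w\<bar> \<le> m \<and> \<bar>x\<bar> \<le> m \<and> (0 < x \<longleftrightarrow> 0 < w)"
    using a m by (simp; arith)+
  then obtain H where H: "admissible H" "\<forall>(w, x)\<in>set ?ps. H w = x"
    using admissible_extension[of ?ps] by blast
  have Hw: "H (1) = m" "H (- 1) = - 1" "H (- 3) = - m + 2" "H (- 2 * l) = - 2" "H (2 * l + 2) = 2"
    using H(2) by simp_all
  \<comment> \<open>Centred arguments along the left diagonal, skeleton classes before twisting
    ones, then the same for the right diagonal.\<close>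
  have c: "cen (3 - 2 * 0) = 3"
    "cen (3 - 2 * 1) = 1"
    "cen (1 * (3 - 2 * 2 + 2 + 0)) = 1"
    "cen (1 * (3 - 2 * (2 + 1) + 2 + 0)) = - 1"
    "cen (1 * (3 - 2 * 4 + 4 + 0)) = - 1"
    "cen (1 * (3 - 2 * (4 + 1) + 4 + 0)) = - 3"
    "cen (t * (1 - 2 * 0)) = - 2 * l"
    "cen (t * (1 - 2 * 1)) = 2 * l"
    "cen (1 * (t * (1 - 2 * 2) + 2 + 0)) = 1"
    "cen (1 * (t * (1 - 2 * (2 + 1)) + 2 + 0)) = - 2 * l"
    "cen (1 * (t * (1 - 2 * 4) + 4 + 0)) = 2 * l + 2"
    "cen (1 * (t * (1 - 2 * (4 + 1)) + 4 + 0)) = 1"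
    by (rule cen_near, use a m in \<open>simp add: algebra_simps\<close>, use a m in arith)+
  let ?cs = "even_skeleton @ twist4 H 1 0 1 2 4"
  have "line_total ?cs (\<lambda>a. 3 - 2 * a) = n" "line_total ?cs (\<lambda>a. t * (1 - 2 * a)) = 1"
    by (unfold line_total_simps append.simps even_skeleton_def twist4_def high_def low_def c Hw; use a m in simp)+
  then show ?thesis
    using H(1) by (intro exI[of _ H]) (simp add: insert_commute)
qed

text \<open>The left diagonal visits the same points of \<open>H\<close> as for
  \<open>n = 6 * l + 1\<close>, but \<open>t\<close> changes the right one, so \<open>H\<close> is
  prescribed anew.\<close>

lemma diagonals_6_mod_5:
  assumes a: "n = 6 * l + 5" "t = 2 * l + 2" "1 \<le> l"
  shows "\<exists>H. admissible H \<and>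
    {line_total (even_skeleton @ twist4 H 1 0 1 2 4) (\<lambda>a. 3 - 2 * a),
     line_total (even_skeleton @ twist4 H 1 0 1 2 4) (\<lambda>a. t * (1 - 2 * a))} = {1, n}"
proof -
  have m: "m = 3 * l + 2" using a n_eq by simp
  let ?ps = "[(1, 1), (- 1, - 2), (- 3, - 1), (2 * l + 2, 3), (- 2 * l, 0)] :: (int \<times> int) list"
  have "distinct (map fst ?ps)" "distinct (map snd ?ps)"
    "\<forall>(w, x)\<in>set ?ps. \<bar>w\<bar> \<le> m \<and> \<bar>x\<bar> \<le> m \<and> (0 < x \<longleftrightarrow> 0 < w)"
    using a m by (simp; arith)+
  then obtain H where H: "admissible H" "\<forall>(w, x)\<in>set ?ps. H w = x"
    using admissible_extension[of ?ps] by blast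
  have Hw: "H (1) = 1" "H (- 1) = - 2" "H (- 3) = - 1" "H (2 * l + 2) = 3" "H (- 2 * l) = 0"
    using H(2) by simp_all
  have c: "cen (3 - 2 * 0) = 3"
    "cen (3 - 2 * 1) = 1"
    "cen (1 * (3 - 2 * 2 + 2 + 0)) = 1"
    "cen (1 * (3 - 2 * (2 + 1) + 2 + 0)) = - 1"
    "cen (1 * (3 - 2 * 4 + 4 + 0)) = - 1"
    "cen (1 * (3 - 2 * (4 + 1) + 4 + 0)) = - 3"
    "cen (t * (1 - 2 * 0)) = 2 * l + 2"
    "cen (t * (1 - 2 * 1)) = - 2 * l - 2"
    "cen (1 * (t * (1 - 2 * 2) + 2 + 0)) = 1"
    "cen (1 * (t * (1 - 2 * (2 + 1)) + 2 + 0)) = 2 * l + 2"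
    "cen (1 * (t * (1 - 2 * 4) + 4 + 0)) = - 2 * l"
    "cen (1 * (t * (1 - 2 * (4 + 1)) + 4 + 0)) = 1"
    by (rule cen_near, use a m in \<open>simp add: algebra_simps\<close>, use a m in arith)+
  let ?cs = "even_skeleton @ twist4 H 1 0 1 2 4"
  have "line_total ?cs (\<lambda>a. 3 - 2 * a) = n" "line_total ?cs (\<lambda>a. t * (1 - 2 * a)) = 1"
    by (unfold line_total_simps append.simps even_skeleton_def twist4_def high_def low_def c Hw; use a m in simp)+
  then show ?thesis
    using H(1) by (intro exI[of _ H]) (simp add: insert_commute)
qed

lemma diagonals_8_mod_1:
  assumes a: "n = 6 * l + 1" "t = - 2 * l" "2 \<le> l"
  shows "\<exists>H. admissible H \<and>
    {line_total (even_skeleton @ twist6 H 1 0 1 (- 2) 5 4 2) (\<lambda>a. 3 - 2 * a),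
     line_total (even_skeleton @ twist6 H 1 0 1 (- 2) 5 4 2) (\<lambda>a. t * (1 - 2 * a))} = {1, n}"
proof -
  have m: "m = 3 * l" using a n_eq by simp
  let ?ps = "[(5, 1), (3, 2), (- 3, - m + 1), (- 5, - m), (1, m - 2), (2 * l, m - 1), (- 1, 0), (- 2 * l, - 2)] :: (int \<times> int) list"
  have "distinct (map fst ?ps)" "distinct (map snd ?ps)"
    "\<forall>(w, x)\<in>set ?ps. \<bar>w\<bar> \<le> m \<and> \<bar>x\<bar> \<le> m \<and> (0 < x \<longleftrightarrow> 0 < w)"
    using a m by (simp; arith)+
  then obtain H where H: "admissible H" "\<forall>(w, x)\<in>set ?ps. H w = x"
    using admissible_extension[of ?ps] by blast
  have Hw: "H (5) = 1" "H (3) = 2" "H (- 3) = - m + 1" "H (- 5) = - m" "H (1) = m - 2" "H (2 * l) = m - 1" "H (- 1) = 0" "H (- 2 * l) = - 2"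
    using H(2) by simp_all
  have c: "cen (3 - 2 * 0) = 3"
    "cen (3 - 2 * 1) = 1"
    "cen (1 * (3 - 2 * (- 2) + (- 2) + 0)) = 5"
    "cen (1 * (3 - 2 * ((- 2) + 1) + (- 2) + 0)) = 3"
    "cen (1 * (3 - 2 * 5 + 5 - 1 + 0)) = - 3"
    "cen (1 * (3 - 2 * (5 + 4 - 2 - 1) + 5 - 1 + 0)) = - 5"
    "cen (1 * (3 - 2 * 4 + 2 + 0)) = - 3"
    "cen (1 * (3 - 2 * 2 + 2 + 0)) = 1"
    "cen (t * (1 - 2 * 0)) = - 2 * l"
    "cen (t * (1 - 2 * 1)) = 2 * l"
    "cen (1 * (t * (1 - 2 * (- 2)) + (- 2) + 0)) = 2 * l"
    "cen (1 * (t * (1 - 2 * ((- 2) + 1)) + (- 2) + 0)) = - 1"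
    "cen (1 * (t * (1 - 2 * 5) + 5 - 1 + 0)) = 1"
    "cen (1 * (t * (1 - 2 * (5 + 4 - 2 - 1)) + 5 - 1 + 0)) = - 2 * l"
    "cen (1 * (t * (1 - 2 * 4) + 2 + 0)) = 2 * l"
    "cen (1 * (t * (1 - 2 * 2) + 2 + 0)) = 1"
    by (rule cen_near, use a m in \<open>simp add: algebra_simps\<close>, use a m in arith)+
  let ?cs = "even_skeleton @ twist6 H 1 0 1 (- 2) 5 4 2"
  have "line_total ?cs (\<lambda>a. 3 - 2 * a) = n" "line_total ?cs (\<lambda>a. t * (1 - 2 * a)) = 1"
    by (unfold line_total_simps append.simps even_skeleton_def twist6_def high_def low_def c Hw; use a m in simp)+
  then show ?thesis
    using H(1) by (intro exI[of _ H]) (simp add: insert_commute)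
qed

lemma diagonals_8_mod_5:
  assumes a: "n = 6 * l + 5" "t = 2 * l + 2" "1 \<le> l"
  shows "\<exists>H. admissible H \<and>
    {line_total (even_skeleton @ twist6 H 1 0 1 (- 2) 5 4 2) (\<lambda>a. 3 - 2 * a),
     line_total (even_skeleton @ twist6 H 1 0 1 (- 2) 5 4 2) (\<lambda>a. t * (1 - 2 * a))} = {1, n}"
proof -
  have m: "m = 3 * l + 2" using a n_eq by simp
  let ?ps = "[(5, 1), (3, 2), (- 3, - m + 2), (- 5, - m), (1, m), (- 2 * l - 2, 0), (- 1, - 2), (2 * l + 2, 3)] :: (int \<times> int) list"
  have "distinct (map fst ?ps)" "distinct (map snd ?ps)"
    "\<forall>(w, x)\<in>set ?ps. \<bar>w\<bar> \<le> m \<and> \<bar>x\<bar> \<le> m \<and> (0 < x \<longleftrightarrow> 0 < w)"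
    using a m by (simp; arith)+
  then obtain H where H: "admissible H" "\<forall>(w, x)\<in>set ?ps. H w = x"
    using admissible_extension[of ?ps] by blast
  have Hw: "H (5) = 1" "H (3) = 2" "H (- 3) = - m + 2" "H (- 5) = - m" "H (1) = m" "H (- 2 * l - 2) = 0" "H (- 1) = - 2" "H (2 * l + 2) = 3"
    using H(2) by simp_all
  have c: "cen (3 - 2 * 0) = 3"
    "cen (3 - 2 * 1) = 1"
    "cen (1 * (3 - 2 * (- 2) + (- 2) + 0)) = 5"
    "cen (1 * (3 - 2 * ((- 2) + 1) + (- 2) + 0)) = 3"
    "cen (1 * (3 - 2 * 5 + 5 - 1 + 0)) = - 3"
    "cen (1 * (3 - 2 * (5 + 4 - 2 - 1) + 5 - 1 + 0)) = - 5"
    "cen (1 * (3 - 2 * 4 + 2 + 0)) = - 3"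
    "cen (1 * (3 - 2 * 2 + 2 + 0)) = 1"
    "cen (t * (1 - 2 * 0)) = 2 * l + 2"
    "cen (t * (1 - 2 * 1)) = - 2 * l - 2"
    "cen (1 * (t * (1 - 2 * (- 2)) + (- 2) + 0)) = - 2 * l - 2"
    "cen (1 * (t * (1 - 2 * ((- 2) + 1)) + (- 2) + 0)) = - 1"
    "cen (1 * (t * (1 - 2 * 5) + 5 - 1 + 0)) = 1"
    "cen (1 * (t * (1 - 2 * (5 + 4 - 2 - 1)) + 5 - 1 + 0)) = 2 * l + 2"
    "cen (1 * (t * (1 - 2 * 4) + 2 + 0)) = - 2 * l - 2"
    "cen (1 * (t * (1 - 2 * 2) + 2 + 0)) = 1"
    by (rule cen_near, use a m in \<open>simp add: algebra_simps\<close>, use a m in arith)+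
  let ?cs = "even_skeleton @ twist6 H 1 0 1 (- 2) 5 4 2"
  have "line_total ?cs (\<lambda>a. 3 - 2 * a) = n" "line_total ?cs (\<lambda>a. t * (1 - 2 * a)) = 1"
    by (unfold line_total_simps append.simps even_skeleton_def twist6_def high_def low_def c Hw; use a m in simp)+
  then show ?thesis
    using H(1) by (intro exI[of _ H]) (simp add: insert_commute)
qed

text \<open>The arguments of \<open>H\<close> are now quarters modulo \<open>n\<close>, hence points
  near multiples of \<open>l\<close> appear even on the left diagonal.\<close>

lemma diagonals_7_mod_1:
  assumes a: "n = 6 * l + 1" "t = - 2 * l" "2 \<le> l"
  shows "\<exists>H. admissible H \<and>
    {line_total (odd_skeleton @ twist4 H ((m + 1) * (m + 1)) 2 4 (- 8) (- 6)) (\<lambda>a. - 6 - 2 * a),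
     line_total (odd_skeleton @ twist4 H ((m + 1) * (m + 1)) 2 4 (- 8) (- 6)) (\<lambda>a. t * (12 - 2 * a))} = {1, n}"
proof -
  have m: "m = 3 * l" using a n_eq by simp
  let ?ps = "[(1, m - 1), (- 1, - m), (- 3 * l, - m + 1), (3 * l - 1, m), (l + 1, 3), (- l, - m + 2), (- 2 * l, 0)] :: (int \<times> int) list"
  have "distinct (map fst ?ps)" "distinct (map snd ?ps)"
    "\<forall>(w, x)\<in>set ?ps. \<bar>w\<bar> \<le> m \<and> \<bar>x\<bar> \<le> m \<and> (0 < x \<longleftrightarrow> 0 < w)"
    using a m by (simp; arith)+
  then obtain H where H: "admissible H" "\<forall>(w, x)\<in>set ?ps. H w = x"
    using admissible_extension[of ?ps] by blast
  have Hw: "H (1) = m - 1" "H (- 1) = - m" "H (- 3 * l) = - m + 1" "H (3 * l - 1) = m" "H (l + 1) = 3" "H (- l) = - m + 2" "H (- 2 * l) = 0"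
    using H(2) by simp_all
  have c: "cen ((m + 1) * (- 6 - 2 * - 1 - 1)) = 3 * l - 2"
    "cen ((m + 1) * (- 6 - 2 * 0)) = - 3"
    "cen ((m + 1) * (- 6 - 2 * 1 + 1)) = 3 * l - 3"
    "cen ((m + 1) * (m + 1) * (- 6 - 2 * (- 8) + (- 8) + 2)) = 1"
    "cen ((m + 1) * (m + 1) * (- 6 - 2 * ((- 8) + 4) + (- 8) + 2)) = - 1"
    "cen ((m + 1) * (m + 1) * (- 6 - 2 * (- 6) + (- 6) + 2)) = - 3 * l"
    "cen ((m + 1) * (m + 1) * (- 6 - 2 * ((- 6) + 4) + (- 6) + 2)) = 3 * l - 1"
    "cen ((m + 1) * (t * (12 - 2 * - 1) - 1)) = l + 2"
    "cen ((m + 1) * (t * (12 - 2 * 0))) = 2"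
    "cen ((m + 1) * (t * (12 - 2 * 1) + 1)) = - l + 2"
    "cen ((m + 1) * (m + 1) * (t * (12 - 2 * (- 8)) + (- 8) + 2)) = l + 1"
    "cen ((m + 1) * (m + 1) * (t * (12 - 2 * ((- 8) + 4)) + (- 8) + 2)) = - l"
    "cen ((m + 1) * (m + 1) * (t * (12 - 2 * (- 6)) + (- 6) + 2)) = 1"
    "cen ((m + 1) * (m + 1) * (t * (12 - 2 * ((- 6) + 4)) + (- 6) + 2)) = - 2 * l"
    by (rule cen_quarter_near cen_half_near, use a m in \<open>simp add: algebra_simps\<close>, use a m in arith)+
  let ?cs = "odd_skeleton @ twist4 H ((m + 1) * (m + 1)) 2 4 (- 8) (- 6)"
  have "line_total ?cs (\<lambda>a. - 6 - 2 * a) = 1" "line_total ?cs (\<lambda>a. t * (12 - 2 * a)) = n"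
    by (unfold line_total_simps append.simps odd_skeleton_def twist4_def high_def low_def c Hw; use a m in simp)+
  then show ?thesis
    using H(1) by (intro exI[of _ H]) simp
qed

lemma diagonals_7_mod_5:
  assumes a: "n = 6 * l + 5" "t = 2 * l + 2" "2 \<le> l"
  shows "\<exists>H. admissible H \<and>
    {line_total (odd_skeleton @ twist4 H ((m + 1) * (m + 1)) 2 4 (- 8) (- 6)) (\<lambda>a. - 6 - 2 * a),
     line_total (odd_skeleton @ twist4 H ((m + 1) * (m + 1)) 2 4 (- 8) (- 6)) (\<lambda>a. t * (12 - 2 * a))} = {1, n}"
proof -
  have m: "m = 3 * l + 2" using a n_eq by simp
  let ?ps = "[(1, 2), (- 1, 0), (- 3 * l - 2, - m + 2), (3 * l + 1, m - 2), (- l, - m), (l + 1, m - 1), (2 * l + 2, 1)] :: (int \<times> int) list"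
  have "distinct (map fst ?ps)" "distinct (map snd ?ps)"
    "\<forall>(w, x)\<in>set ?ps. \<bar>w\<bar> \<le> m \<and> \<bar>x\<bar> \<le> m \<and> (0 < x \<longleftrightarrow> 0 < w)"
    using a m by (simp; arith)+
  then obtain H where H: "admissible H" "\<forall>(w, x)\<in>set ?ps. H w = x"
    using admissible_extension[of ?ps] by blast
  have Hw: "H (1) = 2" "H (- 1) = 0" "H (- 3 * l - 2) = - m + 2" "H (3 * l + 1) = m - 2" "H (- l) = - m" "H (l + 1) = m - 1" "H (2 * l + 2) = 1"
    using H(2) by simp_all
  have c: "cen ((m + 1) * (- 6 - 2 * - 1 - 1)) = 3 * l"
    "cen ((m + 1) * (- 6 - 2 * 0)) = - 3"
    "cen ((m + 1) * (- 6 - 2 * 1 + 1)) = 3 * l - 1"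
    "cen ((m + 1) * (m + 1) * (- 6 - 2 * (- 8) + (- 8) + 2)) = 1"
    "cen ((m + 1) * (m + 1) * (- 6 - 2 * ((- 8) + 4) + (- 8) + 2)) = - 1"
    "cen ((m + 1) * (m + 1) * (- 6 - 2 * (- 6) + (- 6) + 2)) = - 3 * l - 2"
    "cen ((m + 1) * (m + 1) * (- 6 - 2 * ((- 6) + 4) + (- 6) + 2)) = 3 * l + 1"
    "cen ((m + 1) * (t * (12 - 2 * - 1) - 1)) = - l + 1"
    "cen ((m + 1) * (t * (12 - 2 * 0))) = 2"
    "cen ((m + 1) * (t * (12 - 2 * 1) + 1)) = l + 3"
    "cen ((m + 1) * (m + 1) * (t * (12 - 2 * (- 8)) + (- 8) + 2)) = - l"
    "cen ((m + 1) * (m + 1) * (t * (12 - 2 * ((- 8) + 4)) + (- 8) + 2)) = l + 1"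
    "cen ((m + 1) * (m + 1) * (t * (12 - 2 * (- 6)) + (- 6) + 2)) = 1"
    "cen ((m + 1) * (m + 1) * (t * (12 - 2 * ((- 6) + 4)) + (- 6) + 2)) = 2 * l + 2"
    by (rule cen_quarter_near cen_half_near, use a m in \<open>simp add: algebra_simps\<close>, use a m in arith)+
  let ?cs = "odd_skeleton @ twist4 H ((m + 1) * (m + 1)) 2 4 (- 8) (- 6)"
  have "line_total ?cs (\<lambda>a. - 6 - 2 * a) = n" "line_total ?cs (\<lambda>a. t * (12 - 2 * a)) = 1"
    by (unfold line_total_simps append.simps odd_skeleton_def twist4_def high_def low_def c Hw; use a m in simp)+
  then show ?thesis
    using H(1) by (intro exI[of _ H]) (simp add: insert_commute)
qed

text \<open>For \<open>l = 1\<close> the points \<open>- l\<close> and \<open>- 1\<close> of the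
  general prescription coincide, and so do \<open>2 * l + 2\<close> and \<open>3 * l + 1\<close>,
  with conflicting values; order 11 gets its own \<open>H\<close>.\<close>

lemma diagonals_7_order_11:
  assumes a: "n = 11" "t = 4"
  shows "\<exists>H. admissible H \<and>
    {line_total (odd_skeleton @ twist4 H ((m + 1) * (m + 1)) 2 4 (- 8) (- 6)) (\<lambda>a. - 6 - 2 * a),
     line_total (odd_skeleton @ twist4 H ((m + 1) * (m + 1)) 2 4 (- 8) (- 6)) (\<lambda>a. t * (12 - 2 * a))} = {1, n}"
proof -
  have m: "m = 5" using a n_eq by simp
  let ?ps = "[(- 1, - 5), (- 5, 0), (1, 2), (4, 1), (2, 4)] :: (int \<times> int) list"
  have "distinct (map fst ?ps)" "distinct (map snd ?ps)"
    "\<forall>(w, x)\<in>set ?ps. \<bar>w\<bar> \<le> m \<and> \<bar>x\<bar> \<le> m \<and> (0 < x \<longleftrightarrow> 0 < w)"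
    using a m by (simp; arith)+
  then obtain H where H: "admissible H" "\<forall>(w, x)\<in>set ?ps. H w = x"
    using admissible_extension[of ?ps] by blast
  have Hw: "H (- 1) = - 5" "H (- 5) = 0" "H (1) = 2" "H (4) = 1" "H (2) = 4"
    using H(2) by simp_all
  have c: "cen ((m + 1) * (- 6 - 2 * - 1 - 1)) = 3"
    "cen ((m + 1) * (- 6 - 2 * 0)) = - 3"
    "cen ((m + 1) * (- 6 - 2 * 1 + 1)) = 2"
    "cen ((m + 1) * (m + 1) * (- 6 - 2 * (- 8) + (- 8) + 2)) = 1"
    "cen ((m + 1) * (m + 1) * (- 6 - 2 * ((- 8) + 4) + (- 8) + 2)) = - 1"
    "cen ((m + 1) * (m + 1) * (- 6 - 2 * (- 6) + (- 6) + 2)) = - 5"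
    "cen ((m + 1) * (m + 1) * (- 6 - 2 * ((- 6) + 4) + (- 6) + 2)) = 4"
    "cen ((m + 1) * (t * (12 - 2 * - 1) - 1)) = 0"
    "cen ((m + 1) * (t * (12 - 2 * 0))) = 2"
    "cen ((m + 1) * (t * (12 - 2 * 1) + 1)) = 4"
    "cen ((m + 1) * (m + 1) * (t * (12 - 2 * (- 8)) + (- 8) + 2)) = - 1"
    "cen ((m + 1) * (m + 1) * (t * (12 - 2 * ((- 8) + 4)) + (- 8) + 2)) = 2"
    "cen ((m + 1) * (m + 1) * (t * (12 - 2 * (- 6)) + (- 6) + 2)) = 1"
    "cen ((m + 1) * (m + 1) * (t * (12 - 2 * ((- 6) + 4)) + (- 6) + 2)) = 4"
    by (rule cen_quarter_near cen_half_near, use a m in \<open>simp add: algebra_simps\<close>, use a m in arith)+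
  let ?cs = "odd_skeleton @ twist4 H ((m + 1) * (m + 1)) 2 4 (- 8) (- 6)"
  have "line_total ?cs (\<lambda>a. - 6 - 2 * a) = n" "line_total ?cs (\<lambda>a. t * (12 - 2 * a)) = 1"
    by (unfold line_total_simps append.simps odd_skeleton_def twist4_def high_def low_def c Hw; use a m in simp)+
  then show ?thesis
    using H(1) by (intro exI[of _ H]) (simp add: insert_commute)
qed

lemma diagonals_9_mod_1:
  assumes a: "n = 6 * l + 1" "t = - 2 * l" "2 \<le> l"
  shows "\<exists>H. admissible H \<and>
    {line_total (odd_skeleton @ twist6 H ((m + 1) * (m + 1)) 2 4 (- 2) (- 4) (- 3) (- 6)) (\<lambda>a. - 2 - 2 * a),
     line_total (odd_skeleton @ twist6 H ((m + 1) * (m + 1)) 2 4 (- 2) (- 4) (- 3) (- 6)) (\<lambda>a. t * (6 - 2 * a))} = {1, n}"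
proof -
  have m: "m = 3 * l" using a n_eq by simp
  let ?ps = "[(- 3 * l, 0), (3 * l - 1, 1), (0, - 2), (- 3 * l + 1, - 3), (l + 1, 2), (- l, - m + 2), (2 * l, 3), (l, m)] :: (int \<times> int) list"
  have "distinct (map fst ?ps)" "distinct (map snd ?ps)"
    "\<forall>(w, x)\<in>set ?ps. \<bar>w\<bar> \<le> m \<and> \<bar>x\<bar> \<le> m \<and> (0 < x \<longleftrightarrow> 0 < w)"
    using a m by (simp; arith)+
  then obtain H where H: "admissible H" "\<forall>(w, x)\<in>set ?ps. H w = x"
    using admissible_extension[of ?ps] by blast
  have Hw: "H (- 3 * l) = 0" "H (3 * l - 1) = 1" "H (0) = - 2" "H (- 3 * l + 1) = - 3" "H (l + 1) = 2" "H (- l) = - m + 2" "H (2 * l) = 3" "H (l) = m"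
    using H(2) by simp_all
  have c: "cen ((m + 1) * (- 2 - 2 * - 1 - 1)) = 3 * l"
    "cen ((m + 1) * (- 2 - 2 * 0)) = - 1"
    "cen ((m + 1) * (- 2 - 2 * 1 + 1)) = 3 * l - 1"
    "cen ((m + 1) * (m + 1) * (- 2 - 2 * (- 2) + (- 2) + 2)) = - 3 * l"
    "cen ((m + 1) * (m + 1) * (- 2 - 2 * ((- 2) + 4) + (- 2) + 2)) = 3 * l - 1"
    "cen ((m + 1) * (m + 1) * (- 2 - 2 * (- 4) + (- 4) - 4 + 2)) = 0"
    "cen ((m + 1) * (m + 1) * (- 2 - 2 * ((- 4) + (- 3) - (- 6) - 4) + (- 4) - 4 + 2)) = - 3 * l"
    "cen ((m + 1) * (m + 1) * (- 2 - 2 * (- 3) + (- 6) + 2)) = 0"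
    "cen ((m + 1) * (m + 1) * (- 2 - 2 * (- 6) + (- 6) + 2)) = - 3 * l + 1"
    "cen ((m + 1) * (t * (6 - 2 * - 1) - 1)) = l + 1"
    "cen ((m + 1) * (t * (6 - 2 * 0))) = 1"
    "cen ((m + 1) * (t * (6 - 2 * 1) + 1)) = - l + 1"
    "cen ((m + 1) * (m + 1) * (t * (6 - 2 * (- 2)) + (- 2) + 2)) = l + 1"
    "cen ((m + 1) * (m + 1) * (t * (6 - 2 * ((- 2) + 4)) + (- 2) + 2)) = - l"
    "cen ((m + 1) * (m + 1) * (t * (6 - 2 * (- 4)) + (- 4) - 4 + 2)) = 2 * l"
    "cen ((m + 1) * (m + 1) * (t * (6 - 2 * ((- 4) + (- 3) - (- 6) - 4)) + (- 4) - 4 + 2)) = l"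
    "cen ((m + 1) * (m + 1) * (t * (6 - 2 * (- 3)) + (- 6) + 2)) = 0"
    "cen ((m + 1) * (m + 1) * (t * (6 - 2 * (- 6)) + (- 6) + 2)) = - 3 * l"
    by (rule cen_quarter_near cen_half_near, use a m in \<open>simp add: algebra_simps\<close>, use a m in arith)+
  let ?cs = "odd_skeleton @ twist6 H ((m + 1) * (m + 1)) 2 4 (- 2) (- 4) (- 3) (- 6)"
  have "line_total ?cs (\<lambda>a. - 2 - 2 * a) = 1" "line_total ?cs (\<lambda>a. t * (6 - 2 * a)) = n"
    by (unfold line_total_simps append.simps odd_skeleton_def twist6_def high_def low_def c Hw; use a m in simp)+
  then show ?thesis
    using H(1) by (intro exI[of _ H]) simp
qed

lemma diagonals_9_mod_5:
  assumes a: "n = 6 * l + 5" "t = 2 * l + 2" "2 \<le> l"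
  shows "\<exists>H. admissible H \<and>
    {line_total (odd_skeleton @ twist6 H ((m + 1) * (m + 1)) 2 4 (- 2) (- 4) (- 3) (- 6)) (\<lambda>a. - 2 - 2 * a),
     line_total (odd_skeleton @ twist6 H ((m + 1) * (m + 1)) 2 4 (- 2) (- 4) (- 3) (- 6)) (\<lambda>a. t * (6 - 2 * a))} = {1, n}"
proof -
  have m: "m = 3 * l + 2" using a n_eq by simp
  let ?ps = "[(- 3 * l - 2, 0), (3 * l + 1, 3), (0, - m), (- 3 * l - 1, - 1), (- l, - 2), (l + 1, m), (- 2 * l - 2, - m + 2), (- l - 1, - m + 1)] :: (int \<times> int) list"
  have "distinct (map fst ?ps)" "distinct (map snd ?ps)"
    "\<forall>(w, x)\<in>set ?ps. \<bar>w\<bar> \<le> m \<and> \<bar>x\<bar> \<le> m \<and> (0 < x \<longleftrightarrow> 0 < w)"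
    using a m by (simp; arith)+
  then obtain H where H: "admissible H" "\<forall>(w, x)\<in>set ?ps. H w = x"
    using admissible_extension[of ?ps] by blast
  have Hw: "H (- 3 * l - 2) = 0" "H (3 * l + 1) = 3" "H (0) = - m" "H (- 3 * l - 1) = - 1" "H (- l) = - 2" "H (l + 1) = m" "H (- 2 * l - 2) = - m + 2" "H (- l - 1) = - m + 1"
    using H(2) by simp_all
  have c: "cen ((m + 1) * (- 2 - 2 * - 1 - 1)) = 3 * l + 2"
    "cen ((m + 1) * (- 2 - 2 * 0)) = - 1"
    "cen ((m + 1) * (- 2 - 2 * 1 + 1)) = 3 * l + 1"
    "cen ((m + 1) * (m + 1) * (- 2 - 2 * (- 2) + (- 2) + 2)) = - 3 * l - 2"
    "cen ((m + 1) * (m + 1) * (- 2 - 2 * ((- 2) + 4) + (- 2) + 2)) = 3 * l + 1"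
    "cen ((m + 1) * (m + 1) * (- 2 - 2 * (- 4) + (- 4) - 4 + 2)) = 0"
    "cen ((m + 1) * (m + 1) * (- 2 - 2 * ((- 4) + (- 3) - (- 6) - 4) + (- 4) - 4 + 2)) = - 3 * l - 2"
    "cen ((m + 1) * (m + 1) * (- 2 - 2 * (- 3) + (- 6) + 2)) = 0"
    "cen ((m + 1) * (m + 1) * (- 2 - 2 * (- 6) + (- 6) + 2)) = - 3 * l - 1"
    "cen ((m + 1) * (t * (6 - 2 * - 1) - 1)) = - l"
    "cen ((m + 1) * (t * (6 - 2 * 0))) = 1"
    "cen ((m + 1) * (t * (6 - 2 * 1) + 1)) = l + 2"
    "cen ((m + 1) * (m + 1) * (t * (6 - 2 * (- 2)) + (- 2) + 2)) = - l"
    "cen ((m + 1) * (m + 1) * (t * (6 - 2 * ((- 2) + 4)) + (- 2) + 2)) = l + 1"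
    "cen ((m + 1) * (m + 1) * (t * (6 - 2 * (- 4)) + (- 4) - 4 + 2)) = - 2 * l - 2"
    "cen ((m + 1) * (m + 1) * (t * (6 - 2 * ((- 4) + (- 3) - (- 6) - 4)) + (- 4) - 4 + 2)) = - l - 1"
    "cen ((m + 1) * (m + 1) * (t * (6 - 2 * (- 3)) + (- 6) + 2)) = 0"
    "cen ((m + 1) * (m + 1) * (t * (6 - 2 * (- 6)) + (- 6) + 2)) = - 3 * l - 2"
    by (rule cen_quarter_near cen_half_near, use a m in \<open>simp add: algebra_simps\<close>, use a m in arith)+
  let ?cs = "odd_skeleton @ twist6 H ((m + 1) * (m + 1)) 2 4 (- 2) (- 4) (- 3) (- 6)"
  have "line_total ?cs (\<lambda>a. - 2 - 2 * a) = n" "line_total ?cs (\<lambda>a. t * (6 - 2 * a)) = 1"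
    by (unfold line_total_simps append.simps odd_skeleton_def twist6_def high_def low_def c Hw; use a m in simp)+
  then show ?thesis
    using H(1) by (intro exI[of _ H]) (simp add: insert_commute)
qed

section \<open>Assembling squares of all densities\<close>

text \<open>The enlarged window still has length at most \<open>n\<close>, so its class numbers are
  distinct modulo \<open>n\<close>. The shifts \<open>\<alpha>\<close> and \<open>\<beta>\<close>
  realise the diagonal parameters \<open>\<mu>\<close> and \<open>\<nu>\<close>.\<close>

lemma regular_sams_extend:
  fixes N :: nat and \<alpha> \<beta> :: int
  assumes N: "n = int N" and cs: "window_classes lo hi cs" "length cs = k"
    and totals: "range (\<lambda>v. line_total cs (\<lambda>_. v)) \<union> range (\<lambda>y. line_total cs (\<lambda>a. y - a)) \<union>
      {line_total cs (\<lambda>a. \<mu> - 2 * a), line_total cs (\<lambda>a. t * (\<nu> - 2 * a))} = {-n..n + 1}"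
    and \<mu>: "\<mu> = \<beta> - \<alpha>" and \<nu>: "\<nu> = \<alpha> + \<beta>"
    and room: "lo \<le> hi" "hi - lo + 1 + 4 * int b \<le> n" "k + 4 * b < N" "0 < k"
  shows "\<exists>A. regular_sams N (k + 4 * b) A"
proof -
  obtain ds where ds: "window_classes lo (hi + 4 * int b) ds" "length ds = k + 4 * b"
    "\<forall>v. line_total ds (\<lambda>_. v) = line_total cs (\<lambda>_. v)"
    "\<forall>y. line_total ds (\<lambda>a. y - a) = line_total cs (\<lambda>a. y - a)"
    "line_total ds (\<lambda>a. \<mu> - 2 * a) = line_total cs (\<lambda>a. \<mu> - 2 * a)"
    "line_total ds (\<lambda>a. t * (\<nu> - 2 * a)) = line_total cs (\<lambda>a. t * (\<nu> - 2 * a))"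
    using add_quadruples[OF cs(1) room(1)] unfolding cs(2) by blast
  have "inj_on (\<lambda>a. a mod n) (fst ` set ds)"
  proof (rule inj_onI)
    fix a a' assume a: "a \<in> fst ` set ds" "a' \<in> fst ` set ds" "a mod n = a' mod n"
    then have "a \<in> {lo..hi + 4 * int b}" "a' \<in> {lo..hi + 4 * int b}"
      using ds(1) unfolding window_classes_def by blast+
    then have "\<bar>a - a'\<bar> < n" using room(2) by auto
    moreover have "n dvd a - a'" using a(3) by (simp add: mod_eq_dvd_iff)
    ultimately show "a = a'" using zdvd_imp_le[of n "\<bar>a - a'\<bar>"] by (cases "a = a'") auto
  qed
  then have "distinct (map ((\<lambda>a. a mod n) \<circ> fst) ds)"
    using ds(1) unfolding window_classes_def by (simp add: distinct_map comp_inj_on)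
  then have "distinct (map (\<lambda>(a, p). a mod n) ds)"
    by (simp add: comp_def case_prod_unfold)
  moreover have "\<forall>(a, p)\<in>set ds. bperm p"
    using ds(1) unfolding window_classes_def by blast
  moreover have "0 < length ds" using room(4) ds(2) by simp
  moreover have "range (\<lambda>v. line_total ds (\<lambda>_. v)) \<union> range (\<lambda>y. line_total ds (\<lambda>a. y - a)) \<union>
      {line_total ds (\<lambda>a. \<beta> - \<alpha> - 2 * a), line_total ds (\<lambda>a. t * (\<alpha> + \<beta> - 2 * a))} = {-n..n + 1}"
    using ds(3-6) totals unfolding \<mu> \<nu> by simp
  ultimately show ?thesis
    using regular_sams_of_classes[OF N, of ds] ds(2) room(3) by metis
qed

text \<open>In the two cases \<open>3 * t\<close> equals \<open>1 - n\<close> and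
  \<open>n + 1\<close>, so \<open>t\<close> inverts 3; the bounds on \<open>l\<close> express
  \<open>n \<ge> 11\<close>.\<close>

definition residue_case :: "int \<Rightarrow> bool" where
  "residue_case l \<longleftrightarrow> (n = 6 * l + 1 \<and> t = - 2 * l \<and> 2 \<le> l) \<or> (n = 6 * l + 5 \<and> t = 2 * l + 2 \<and> 1 \<le> l)"

lemma regular_sams_6:
  assumes l: "residue_case l" and N: "n = int N" "6 + 4 * b + 3 \<le> N"
  shows "\<exists>A. regular_sams N (6 + 4 * b) A"
proof -
  obtain H where H: "admissible H"
    "{line_total (even_skeleton @ twist4 H 1 0 1 2 4) (\<lambda>a. 3 - 2 * a),
      line_total (even_skeleton @ twist4 H 1 0 1 2 4) (\<lambda>a. t * (1 - 2 * a))} = {1, n}"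
    using l diagonals_6_mod_1[of l] diagonals_6_mod_5[of l] unfolding residue_case_def by blast
  let ?cs = "even_skeleton @ twist4 H 1 0 1 2 4"
  have w: "window_classes 0 5 ?cs"
  proof -
    have "\<forall>(a, p)\<in>set ?cs. bperm p"
      unfolding set_append ball_Un
      using bperm_skeleton(1) bperm_twist(1)[OF H(1) coprime_1_left] by blast
    then show ?thesis
      unfolding window_classes_def by (intro conjI) (assumption | simp add: even_skeleton_def twist4_def)+
  qed
  have len: "length ?cs = 6" by (simp add: even_skeleton_def twist4_def)
  have tot: "range (\<lambda>v. line_total ?cs (\<lambda>_. v)) \<union> range (\<lambda>y. line_total ?cs (\<lambda>a. y - a)) \<union>
      {line_total ?cs (\<lambda>a. 3 - 2 * a), line_total ?cs (\<lambda>a. t * (1 - 2 * a))} = {-n..n + 1}"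
    by (rule even_totals[OF H(2) twist_row(1)]) (simp add: twist_col(1)[OF H(1)])
  show ?thesis
    \<comment> \<open>\<open>\<beta> = 2\<close> and \<open>\<alpha> = -1\<close> have difference 3
      and sum 1, the two diagonal parameters.\<close>
    by (rule regular_sams_extend[OF N(1) w len tot, of 2 "-1"]) (use N in simp_all)
qed

lemma regular_sams_8:
  assumes l: "residue_case l" and N: "n = int N" "8 + 4 * b + 3 \<le> N"
  shows "\<exists>A. regular_sams N (8 + 4 * b) A"
proof -
  obtain H where H: "admissible H"
    "{line_total (even_skeleton @ twist6 H 1 0 1 (- 2) 5 4 2) (\<lambda>a. 3 - 2 * a),
      line_total (even_skeleton @ twist6 H 1 0 1 (- 2) 5 4 2) (\<lambda>a. t * (1 - 2 * a))} = {1, n}"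
    using l diagonals_8_mod_1[of l] diagonals_8_mod_5[of l] unfolding residue_case_def by blast
  let ?cs = "even_skeleton @ twist6 H 1 0 1 (- 2) 5 4 2"
  have w: "window_classes (- 2) 6 ?cs"
  proof -
    have "\<forall>(a, p)\<in>set ?cs. bperm p"
      unfolding set_append ball_Un
      using bperm_skeleton(1) bperm_twist(2)[OF H(1) coprime_1_left] by blast
    then show ?thesis
      unfolding window_classes_def by (intro conjI) (assumption | simp add: even_skeleton_def twist6_def)+
  qed
  have len: "length ?cs = 8" by (simp add: even_skeleton_def twist6_def)
  have tot: "range (\<lambda>v. line_total ?cs (\<lambda>_. v)) \<union> range (\<lambda>y. line_total ?cs (\<lambda>a. y - a)) \<union>
      {line_total ?cs (\<lambda>a. 3 - 2 * a), line_total ?cs (\<lambda>a. t * (1 - 2 * a))} = {-n..n + 1}"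
    by (rule even_totals[OF H(2) twist_row(2)]) (simp add: twist_col(2)[OF H(1)])
  show ?thesis
    by (rule regular_sams_extend[OF N(1) w len tot, of 2 "-1"]) (use N in simp_all)
qed

text \<open>The condition \<open>q * s = 1\<close> of the twist for the odd configurations:
  \<open>q\<close> is a quarter and \<open>s = 4\<close>.\<close>

lemma quarter: "[(m + 1) * (m + 1) * 4 = 1] (mod n)"
proof -
  have "[2 * ((m + 1) * (2 * (m + 1))) = 2 * (m + 1)] (mod n)" by (rule half)
  moreover have "[2 * (m + 1) = 1] (mod n)" using half[of 1] by simp
  ultimately have "[2 * ((m + 1) * (2 * (m + 1))) = 1] (mod n)" by (rule cong_trans)
  then show ?thesis by (simp only: ac_simps) (simp add: algebra_simps)
qed

lemma coprime_quarter: "coprime ((m + 1) * (m + 1)) n"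
  using coprime_half by simp

text \<open>The seven classes occupy a window of length 10, which with \<open>4 * b\<close> further
  classes fits into \<open>n\<close> residues precisely when the density is at most
  \<open>n - 3\<close>.\<close>

lemma regular_sams_7:
  assumes l: "residue_case l" and N: "n = int N" "7 + 4 * b + 3 \<le> N"
  shows "\<exists>A. regular_sams N (7 + 4 * b) A"
proof -
  let ?tw = "\<lambda>H. twist4 H ((m + 1) * (m + 1)) 2 4 (- 8) (- 6)"
  consider "n = 6 * l + 1" "t = - 2 * l" "2 \<le> l" | "n = 6 * l + 5" "t = 2 * l + 2" "2 \<le> l"
    | "n = 11" "t = 4"
    using l unfolding residue_case_def by (cases "l = 1") auto
  then have "\<exists>H. admissible H \<and>
    {line_total (odd_skeleton @ ?tw H) (\<lambda>a. - 6 - 2 * a),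
     line_total (odd_skeleton @ ?tw H) (\<lambda>a. t * (12 - 2 * a))} = {1, n}"
    by cases (use diagonals_7_mod_1[of l] diagonals_7_mod_5[of l] diagonals_7_order_11 in blast)+
  then obtain H where H: "admissible H"
    "{line_total (odd_skeleton @ ?tw H) (\<lambda>a. - 6 - 2 * a),
      line_total (odd_skeleton @ ?tw H) (\<lambda>a. t * (12 - 2 * a))} = {1, n}"
    by blast
  let ?cs = "odd_skeleton @ ?tw H"
  have w: "window_classes (- 8) 1 ?cs"
  proof -
    have "\<forall>(a, p)\<in>set ?cs. bperm p"
      unfolding set_append ball_Un
      using bperm_skeleton(2) bperm_twist(1)[OF H(1) coprime_quarter] by blast
    then show ?thesis
      unfolding window_classes_def by (intro conjI) (assumption | simp add: odd_skeleton_def twist4_def)+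
  qed
  have len: "length ?cs = 7" by (simp add: odd_skeleton_def twist4_def)
  have tot: "range (\<lambda>v. line_total ?cs (\<lambda>_. v)) \<union> range (\<lambda>y. line_total ?cs (\<lambda>a. y - a)) \<union>
      {line_total ?cs (\<lambda>a. - 6 - 2 * a), line_total ?cs (\<lambda>a. t * (12 - 2 * a))} = {-n..n + 1}"
    by (rule odd_totals[OF H(2) twist_row(1)]) (rule twist_col(1)[OF H(1) quarter])
  show ?thesis
    by (rule regular_sams_extend[OF N(1) w len tot, of 3 9]) (use N in simp_all)
qed

lemma regular_sams_9:
  assumes l: "residue_case l" and N: "n = int N" "9 + 4 * b + 3 \<le> N"
  shows "\<exists>A. regular_sams N (9 + 4 * b) A"
proof -
  let ?tw = "\<lambda>H. twist6 H ((m + 1) * (m + 1)) 2 4 (- 2) (- 4) (- 3) (- 6)"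
  \<comment> \<open>\<open>l = 1\<close> would mean order 11, too small for density 9.\<close>
  have "2 \<le> l" using l N unfolding residue_case_def by (cases "l = 1") auto
  then obtain H where H: "admissible H"
    "{line_total (odd_skeleton @ ?tw H) (\<lambda>a. - 2 - 2 * a),
      line_total (odd_skeleton @ ?tw H) (\<lambda>a. t * (6 - 2 * a))} = {1, n}"
    using l diagonals_9_mod_1[of l] diagonals_9_mod_5[of l] unfolding residue_case_def by blast
  let ?cs = "odd_skeleton @ ?tw H"
  have w: "window_classes (- 6) 2 ?cs"
  proof -
    have "\<forall>(a, p)\<in>set ?cs. bperm p"
      unfolding set_append ball_Un
      using bperm_skeleton(2) bperm_twist(2)[OF H(1) coprime_quarter] by blast
    then show ?thesis
      unfolding window_classes_def by (intro conjI) (assumption | simp add: odd_skeleton_def twist6_def)+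
  qed
  have len: "length ?cs = 9" by (simp add: odd_skeleton_def twist6_def)
  have tot: "range (\<lambda>v. line_total ?cs (\<lambda>_. v)) \<union> range (\<lambda>y. line_total ?cs (\<lambda>a. y - a)) \<union>
      {line_total ?cs (\<lambda>a. - 2 - 2 * a), line_total ?cs (\<lambda>a. t * (6 - 2 * a))} = {-n..n + 1}"
    by (rule odd_totals[OF H(2) twist_row(2)]) (rule twist_col(2)[OF H(1) quarter])
  show ?thesis
    by (rule regular_sams_extend[OF N(1) w len tot, of 2 4]) (use N in simp_all)
qed

end

theorem theorem4p5:
  fixes n d :: nat
  assumes "n \<ge> 11"
    and "n mod 6 = 1 \<or> n mod 6 = 5"
    and "6 \<le> d" and "d \<le> n - 3"
  shows "\<exists>A. regular_sams n d A"
proof -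
  define l where "l = int (n div 6)"
  have n: "int n = 6 * l + int (n mod 6)"
    unfolding l_def by presburger
  have "\<exists>m t. knut_vik (int n) m t \<and> knut_vik.residue_case (int n) t l"
    using assms(2)
  proof
    assume r: "n mod 6 = 1"
    then have "2 \<le> l" using n assms(1) by simp
    moreover have "[3 * (- 2 * l) = 1] (mod int n)"
    proof -
      have e: "3 * (- 2 * l) - 1 = - int n" using n r by simp
      show ?thesis unfolding cong_iff_dvd_diff e by simp
    qed
    ultimately have k: "knut_vik (int n) (3 * l) (- 2 * l)"
      using n r by (intro knut_vik.intro) auto
    then show ?thesis
      using n r \<open>2 \<le> l\<close> knut_vik.residue_case_def[OF k] by fastforce
  next
    assume r: "n mod 6 = 5"
    then have "1 \<le> l" using n assms(1) by simp
    moreover have "[3 * (2 * l + 2) = 1] (mod int n)"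
    proof -
      have e: "3 * (2 * l + 2) - 1 = int n" using n r by simp
      show ?thesis unfolding cong_iff_dvd_diff e by simp
    qed
    ultimately have k: "knut_vik (int n) (3 * l + 2) (2 * l + 2)"
      using n r by (intro knut_vik.intro) auto
    then show ?thesis
      using n r \<open>1 \<le> l\<close> knut_vik.residue_case_def[OF k] by fastforce
  qed
  then obtain m t where "knut_vik (int n) m t" and l: "knut_vik.residue_case (int n) t l"
    by blast
  then interpret knut_vik "int n" m t by simp
  \<comment> \<open>The residue of \<open>d\<close> modulo 4 selects the starting density among 6,
    7, 8, 9, and \<open>b\<close> counts the neutral quadruples to add.\<close>
  define b where "b = (d - 6) div 4"
  have "d = 6 + 4 * b \<or> d = 7 + 4 * b \<or> d = 8 + 4 * b \<or> d = 9 + 4 * b"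
    unfolding b_def using assms(3) by presburger
  then show ?thesis
    using regular_sams_6[OF l refl, of b] regular_sams_7[OF l refl, of b]
      regular_sams_8[OF l refl, of b] regular_sams_9[OF l refl, of b] assms(1,4) by auto
qed

end
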